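(* Let $H_0$ be a self-adjoint operator and $V$ a bounded non-negative operator on a separable Hilbert space $\mathcal{H}$, $H_\lambda=H_0+\lambda V$ ($\lambda\in\mathbb{R}$), and let $\mathcal{H}_V$ be the smallest reducing subspace for $H_0$ containing $R(V)$. Let $G(z)=\sqrt{V}(H_0-z)^{-1}\sqrt{V}$ for $z\in\mathbb{C}\setminus\mathbb{R}$. Assume that $G(z)$ is compact for all $z\in\mathbb{C}\setminus\mathbb{R}$, and that for Lebesgue-almost every $E\in\mathbb{R}$ the operator-norm limit $G(E+i0)=\lim_{\varepsilon\downarrow0}G(E+i\varepsilon)$ exists and all its non-zero eigenvalues are (algebraically) simple. Then for Lebesgue-almost every $\lambda\in\mathbb{R}$, every eigenvalue of $H_\lambda|_{\mathcal{H}_V}$ is simple.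
   Context: Algebraic simplicity of a non-zero eigenvalue of the (possibly non-self-adjoint) compact operator $G(E+i0)$ means its generalized eigenspace is one-dimensional. *)

theory Defs
  imports "HOL-Analysis.Analysis"
begin

class complex_hilbert = real_normed_vector + complete_space +
  fixes scaleC :: "complex \<Rightarrow> 'a \<Rightarrow> 'a" (infixr \<open>*\<^sub>C\<close> 75)
    and cinner :: "'a \<Rightarrow> 'a \<Rightarrow> complex"
  assumes scaleC_add_right: "a *\<^sub>C (x + y) = a *\<^sub>C x + a *\<^sub>C y"
    and scaleC_add_left: "(a + b) *\<^sub>C x = a *\<^sub>C x + b *\<^sub>C x"
    and scaleC_scaleC: "a *\<^sub>C (b *\<^sub>C x) = (a * b) *\<^sub>C x"
    and scaleC_one: "1 *\<^sub>C x = x"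
    and scaleR_scaleC: "r *\<^sub>R x = complex_of_real r *\<^sub>C x"
    and cinner_commute: "cinner x y = cnj (cinner y x)"
    and cinner_add_right: "cinner x (y + z) = cinner x y + cinner x z"
    and cinner_scaleC_right: "cinner x (a *\<^sub>C y) = a * cinner x y"
    and cinner_norm: "cinner x x = complex_of_real ((norm x)\<^sup>2)"

definition clinear_op :: "('a::complex_hilbert \<Rightarrow> 'a) \<Rightarrow> bool" where
  "clinear_op T \<longleftrightarrow> (\<forall>x y. T (x + y) = T x + T y) \<and> (\<forall>a x. T (a *\<^sub>C x) = a *\<^sub>C T x)"

definition bounded_clinear_op :: "('a::complex_hilbert \<Rightarrow> 'a) \<Rightarrow> bool" where
  "bounded_clinear_op T \<longleftrightarrow> clinear_op T \<and> (\<exists>K. \<forall>x. norm (T x) \<le> norm x * K)"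

definition nonneg_op :: "('a::complex_hilbert \<Rightarrow> 'a) \<Rightarrow> bool" where
  "nonneg_op T \<longleftrightarrow> bounded_clinear_op T \<and>
     (\<forall>x. Im (cinner x (T x)) = 0 \<and> 0 \<le> Re (cinner x (T x)))"

definition op_sqrt :: "('a::complex_hilbert \<Rightarrow> 'a) \<Rightarrow> ('a \<Rightarrow> 'a)" where
  "op_sqrt V = (THE S. nonneg_op S \<and> S \<circ> S = V)"

definition compact_op :: "('a::complex_hilbert \<Rightarrow> 'a) \<Rightarrow> bool" where
  "compact_op T \<longleftrightarrow> bounded_clinear_op T \<and> (\<forall>B. bounded B \<longrightarrow> compact (closure (T ` B)))"

definition csubspace :: "'a::complex_hilbert set \<Rightarrow> bool" where
  "csubspace M \<longleftrightarrow> 0 \<in> M \<and> (\<forall>x\<in>M. \<forall>y\<in>M. x + y \<in> M) \<and> (\<forall>a. \<forall>x\<in>M. a *\<^sub>C x \<in> M)"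

text \<open>A (possibly unbounded) self-adjoint operator with domain \<open>D\<close>: \<open>D\<close> is a dense
subspace, \<open>A\<close> is linear on \<open>D\<close>, and the adjoint of \<open>(D, A)\<close> is \<open>(D, A)\<close>, i.e.
\<open>y \<in> dom(A\<^sup>*)\<close> with \<open>A\<^sup>* y = z\<close> iff \<open>y \<in> D\<close> and \<open>z = A y\<close>.
(Values of \<open>A\<close> outside \<open>D\<close> are irrelevant.)\<close>
definition self_adjoint_op :: "'a::complex_hilbert set \<Rightarrow> ('a \<Rightarrow> 'a) \<Rightarrow> bool" where
  "self_adjoint_op D A \<longleftrightarrow> csubspace D \<and> closure D = UNIV \<and>
     (\<forall>x\<in>D. \<forall>y\<in>D. A (x + y) = A x + A y) \<and> (\<forall>a. \<forall>x\<in>D. A (a *\<^sub>C x) = a *\<^sub>C A x) \<and>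
     (\<forall>y z. (\<forall>x\<in>D. cinner (A x) y = cinner x z) \<longleftrightarrow> (y \<in> D \<and> z = A y))"

definition resolvent :: "'a::complex_hilbert set \<Rightarrow> ('a \<Rightarrow> 'a) \<Rightarrow> complex \<Rightarrow> 'a \<Rightarrow> 'a" where
  "resolvent D A z y = (THE x. x \<in> D \<and> A x - z *\<^sub>C x = y)"

definition Gop :: "'a::complex_hilbert set \<Rightarrow> ('a \<Rightarrow> 'a) \<Rightarrow> ('a \<Rightarrow> 'a) \<Rightarrow> complex \<Rightarrow> 'a \<Rightarrow> 'a" where
  "Gop D H0 V z = op_sqrt V \<circ> resolvent D H0 z \<circ> op_sqrt V"

definition oproj :: "'a::complex_hilbert set \<Rightarrow> 'a \<Rightarrow> 'a" where
  "oproj M x = (THE p. p \<in> M \<and> (\<forall>m\<in>M. cinner m (x - p) = 0))"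

definition reducing_subspace :: "'a::complex_hilbert set \<Rightarrow> ('a \<Rightarrow> 'a) \<Rightarrow> 'a set \<Rightarrow> bool" where
  "reducing_subspace D A M \<longleftrightarrow> csubspace M \<and> closed M \<and>
     (\<forall>x\<in>D. oproj M x \<in> D \<and> A (oproj M x) = oproj M (A x))"

definition HV :: "'a::complex_hilbert set \<Rightarrow> ('a \<Rightarrow> 'a) \<Rightarrow> ('a \<Rightarrow> 'a) \<Rightarrow> 'a set" where
  "HV D A V = \<Inter> {M. reducing_subspace D A M \<and> range V \<subseteq> M}"

definition one_dim :: "'a::complex_hilbert set \<Rightarrow> bool" where
  "one_dim S \<longleftrightarrow> (\<exists>v. v \<noteq> 0 \<and> S = range (\<lambda>c. c *\<^sub>C v))"

definition is_eigenvalue :: "('a::complex_hilbert \<Rightarrow> 'a) \<Rightarrow> complex \<Rightarrow> bool" where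
  "is_eigenvalue T \<mu> \<longleftrightarrow> (\<exists>x. x \<noteq> 0 \<and> T x = \<mu> *\<^sub>C x)"

definition gen_eigenspace :: "('a::complex_hilbert \<Rightarrow> 'a) \<Rightarrow> complex \<Rightarrow> 'a set" where
  "gen_eigenspace T \<mu> = {x. \<exists>n. ((\<lambda>y. T y - \<mu> *\<^sub>C y) ^^ n) x = 0}"

definition algebraically_simple :: "('a::complex_hilbert \<Rightarrow> 'a) \<Rightarrow> complex \<Rightarrow> bool" where
  "algebraically_simple T \<mu> \<longleftrightarrow> one_dim (gen_eigenspace T \<mu>)"

definition restr_eigenspace :: "'a::complex_hilbert set \<Rightarrow> ('a \<Rightarrow> 'a) \<Rightarrow> 'a set \<Rightarrow> complex \<Rightarrow> 'a set" where
  "restr_eigenspace D A M \<mu> = {x \<in> D \<inter> M. A x = \<mu> *\<^sub>C x}"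

end

theory Submission
  imports Defs
begin

text \<open>Let \<open>H\<^sub>t \<psi> = E \<psi>\<close> with \<open>0 \<noteq> \<psi> \<in> H\<^sub>V\<close>. If the boundary value \<open>L = G (E + i0)\<close> exists, then \<open>V\<close>
kills the kernel of \<open>H0 - E\<close>, so the term \<open>\<epsilon> \<surd>V (H0 - E - i\<epsilon>)\<^sup>-\<^sup>1 \<psi>\<close> vanishes in the limit and
\<open>\<surd>V \<psi>\<close> is an eigenvector of \<open>L\<close> at \<open>-1/t\<close>. As \<open>\<surd>V\<close> is injective on the eigenspace of \<open>H\<^sub>t\<close> in
\<open>H\<^sub>V\<close>, that eigenspace is one-dimensional.

It remains to see that for almost every \<open>t\<close> no eigenvalue lies in the null set of exceptional
energies. Two eigenpairs satisfy
\<open>(t' - t) \<langle>\<psi>, V \<psi>'\<rangle> = (E' - E) \<langle>\<psi>, \<psi>'\<rangle>\<close>, and \<open>\<langle>\<psi>, V \<psi>\<rangle> > 0\<close> on \<open>H\<^sub>V\<close>; so after splitting the eigenvectors into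
countably many small pieces, \<open>t\<close> is a Lipschitz function of \<open>E\<close> on each piece, and Lipschitz images
of null sets are null.\<close>

section \<open>Complex inner products and non-negative operators\<close>

lemma scaleC_zero_left [simp]: "0 *\<^sub>C (x::'a::complex_hilbert) = 0"
  using scaleC_add_left[of 0 0 x] by simp

lemma scaleC_zero_right [simp]: "a *\<^sub>C (0::'a::complex_hilbert) = 0"
  using scaleC_add_right[of a 0 "0::'a"] by simp

lemma scaleC_minus_left: "(- a) *\<^sub>C (x::'a::complex_hilbert) = - (a *\<^sub>C x)"
  using scaleC_add_left[of a "- a" x] by (simp add: eq_neg_iff_add_eq_0 add.commute)

lemma scaleC_minus_right: "a *\<^sub>C (- x) = - (a *\<^sub>C (x::'a::complex_hilbert))"
  using scaleC_add_right[of a x "- x"] by (simp add: eq_neg_iff_add_eq_0 add.commute)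

lemma scaleC_diff_right: "a *\<^sub>C (x - y) = a *\<^sub>C (x::'a::complex_hilbert) - a *\<^sub>C y"
  using scaleC_add_right[of a x "- y"] by (simp add: scaleC_minus_right)

lemma cinner_add_left: "cinner (x + y) (z::'a::complex_hilbert) = cinner x z + cinner y z"
  by (metis cinner_add_right cinner_commute complex_cnj_add)

lemma cinner_scaleC_left: "cinner (a *\<^sub>C x) (y::'a::complex_hilbert) = cnj a * cinner x y"
  by (metis cinner_scaleC_right cinner_commute complex_cnj_mult)

lemma cinner_zero_right [simp]: "cinner (x::'a::complex_hilbert) 0 = 0"
  using cinner_add_right[of x 0 0] by simp

lemma cinner_zero_left [simp]: "cinner 0 (x::'a::complex_hilbert) = 0"
  using cinner_add_left[of 0 0 x] by simp

lemma cinner_minus_right: "cinner x (- y) = - cinner x (y::'a::complex_hilbert)"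
  using cinner_add_right[of x y "- y"] by (simp add: eq_neg_iff_add_eq_0 add.commute)

lemma cinner_minus_left: "cinner (- x) y = - cinner x (y::'a::complex_hilbert)"
  using cinner_add_left[of x "- x" y] by (simp add: eq_neg_iff_add_eq_0 add.commute)

lemma cinner_diff_right: "cinner x (y - z) = cinner x y - cinner x (z::'a::complex_hilbert)"
  using cinner_add_right[of x y "- z"] by (simp add: cinner_minus_right)

lemma cinner_diff_left: "cinner (x - y) z = cinner x z - cinner y (z::'a::complex_hilbert)"
  using cinner_add_left[of x "- y" z] by (simp add: cinner_minus_left)

lemmas cinner_simps = cinner_add_left cinner_add_right cinner_diff_left cinner_diff_right
  cinner_scaleC_left cinner_scaleC_right cinner_minus_left cinner_minus_right

lemma cinner_eq_0_iff: "cinner x x = 0 \<longleftrightarrow> (x::'a::complex_hilbert) = 0"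
  by (simp add: cinner_norm)

lemma norm_scaleC: "norm (a *\<^sub>C (x::'a::complex_hilbert)) = cmod a * norm x"
proof -
  have "complex_of_real ((norm (a *\<^sub>C x))\<^sup>2) = complex_of_real ((cmod a * norm x)\<^sup>2)"
  proof -
    have "complex_of_real ((norm (a *\<^sub>C x))\<^sup>2) = cinner (a *\<^sub>C x) (a *\<^sub>C x)"
      by (rule cinner_norm[symmetric])
    also have "\<dots> = (a * cnj a) * cinner x x"
      by (simp add: cinner_scaleC_left cinner_scaleC_right)
    also have "\<dots> = complex_of_real ((cmod a * norm x)\<^sup>2)"
      using complex_norm_square[of a] by (simp add: cinner_norm power_mult_distrib)
    finally show ?thesis .
  qed
  then have "(norm (a *\<^sub>C x))\<^sup>2 = (cmod a * norm x)\<^sup>2"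
    using of_real_eq_iff by blast
  then show ?thesis by simp
qed

lemma clinear_op_diff: "clinear_op T \<Longrightarrow> T (x - y) = T x - T y"
proof -
  assume T: "clinear_op T"
  have "T (x - y) + T y = T x"
    using T by (metis clinear_op_def diff_add_cancel)
  then show ?thesis by (simp add: eq_diff_eq)
qed

lemma bounded_clinear_op_bounded_linear: "bounded_clinear_op T \<Longrightarrow> bounded_linear T"
  unfolding bounded_clinear_op_def clinear_op_def
  by (intro bounded_linear.intro linearI bounded_linear_axioms.intro)
    (auto simp: scaleR_scaleC)

section \<open>Symmetry and the Cauchy-Schwarz inequality for non-negative operators\<close>

lemma nonneg_op_clinear: "nonneg_op T \<Longrightarrow> clinear_op T"
  by (simp add: nonneg_op_def bounded_clinear_op_def)

lemma nonneg_op_bounded_linear: "nonneg_op T \<Longrightarrow> bounded_linear T"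
  by (simp add: nonneg_op_def bounded_clinear_op_bounded_linear)

text \<open>Polarization: reality of the form at \<open>x + y\<close> and at
  \<open>x + \<i> *\<^sub>C y\<close> fixes the imaginary and the real part of
  \<open>cinner x (T y) - cnj (cinner y (T x))\<close>.\<close>

lemma clinear_op_symmetric:
  assumes T: "clinear_op T" and re: "\<And>x. Im (cinner x (T x)) = 0"
  shows "cinner (T x) y = cinner x (T y)"
proof -
  have add: "T (x + y) = T x + T y" and sc: "T (a *\<^sub>C x) = a *\<^sub>C T x" for a x y
    using T by (auto simp: clinear_op_def)
  have 1: "Im (cinner x (T y) + cinner y (T x)) = 0"
    using re[of "x + y"] re[of x] re[of y] by (simp add: add cinner_simps)
  have 2: "Im (\<i> * cinner x (T y) - \<i> * cinner y (T x)) = 0"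
    using re[of "x + \<i> *\<^sub>C y"] re[of x] re[of y] by (simp add: add sc cinner_simps)
  have "cinner (T x) y = cnj (cinner y (T x))" by (rule cinner_commute)
  also have "\<dots> = cinner x (T y)"
    using 1 2 by (simp add: complex_eq_iff)
  finally show ?thesis .
qed

lemma nonneg_op_symmetric: "nonneg_op T \<Longrightarrow> cinner (T x) y = cinner x (T y)"
  by (rule clinear_op_symmetric) (auto simp: nonneg_op_def bounded_clinear_op_def)

text \<open>The form \<open>cinner x (T y)\<close> is only a semi-inner product, so the usual
  discriminant argument needs a separate case for \<open>q = 0\<close>.\<close>

lemma nonneg_op_Cauchy_Schwarz:
  assumes T: "nonneg_op T"
  shows "(cmod (cinner x (T y)))\<^sup>2 \<le> Re (cinner x (T x)) * Re (cinner y (T y))"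
proof -
  define b where "b = cinner x (T y)"
  define q where "q = Re (cinner y (T y))"
  have sc: "T (a *\<^sub>C x) = a *\<^sub>C T x" for a x
    using nonneg_op_clinear[OF T] by (auto simp: clinear_op_def)
  have dif: "T (x - y) = T x - T y" for x y
    using nonneg_op_clinear[OF T] by (rule clinear_op_diff)
  have pos: "0 \<le> Re (cinner x (T x))" and im: "Im (cinner x (T x)) = 0" for x
    using T by (auto simp: nonneg_op_def)
  have yx: "cinner y (T x) = cnj b"
    unfolding b_def by (metis T cinner_commute nonneg_op_symmetric)
  have bb: "cmod b * cmod b = Re b * Re b + Im b * Im b"
    using cmod_power2[of b] by (simp add: power2_eq_square)
  have *: "0 \<le> Re (cinner x (T x)) - 2 * s * (cmod b)\<^sup>2 + s\<^sup>2 * (cmod b)\<^sup>2 * q" for s :: real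
  proof -
    \<comment> \<open>The factor \<open>cnj b\<close> makes \<open>a * b\<close> real, so
      non-negativity of the form at \<open>x - a *\<^sub>C y\<close> becomes a real quadratic
      inequality in \<open>s\<close>.\<close>
    define a where "a = complex_of_real s * cnj b"
    have "Re (cinner (x - a *\<^sub>C y) (T (x - a *\<^sub>C y)))
        = Re (cinner x (T x)) - Re (a * b) - Re (cnj a * cnj b) + Re (cnj a * a * cinner y (T y))"
      by (simp add: dif sc cinner_simps yx b_def[symmetric] algebra_simps)
    also have "\<dots> = Re (cinner x (T x)) - 2 * s * (cmod b)\<^sup>2 + s\<^sup>2 * (cmod b)\<^sup>2 * q"
      by (simp add: a_def q_def im power2_eq_square algebra_simps bb)
    finally show ?thesis using pos by metis
  qed
  show ?thesis
  proof (cases "q = 0")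
    case True
    have "(cmod b)\<^sup>2 = 0"
    proof (rule ccontr)
      assume "(cmod b)\<^sup>2 \<noteq> 0"
      then have "0 < (cmod b)\<^sup>2" by simp
      \<comment> \<open>For \<open>q = 0\<close> the inequality is affine in \<open>s\<close> with
        negative slope; the chosen \<open>s\<close> makes the right-hand side negative.\<close>
      then show False
        using *[of "(Re (cinner x (T x)) + 1) / (cmod b)\<^sup>2"] pos[of x] True by simp
    qed
    then show ?thesis using True by (simp add: q_def b_def)
  next
    case False
    then have q: "q > 0" using pos[of y] by (simp add: q_def)
    \<comment> \<open>The choice \<open>s = 1/q\<close> minimizes the quadratic; multiplying by
      \<open>q\<close> clears the denominator.\<close>
    have "0 \<le> (Re (cinner x (T x)) - 2 * (1/q) * (cmod b)\<^sup>2 + (1/q)\<^sup>2 * (cmod b)\<^sup>2 * q) * q"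
      using *[of "1/q"] q by (intro mult_nonneg_nonneg) auto
    also have "\<dots> = Re (cinner x (T x)) * q - (cmod b)\<^sup>2"
      using q by (simp add: field_simps power2_eq_square)
    finally show ?thesis by (simp add: q_def b_def)
  qed
qed

text \<open>Makes the ordinary Cauchy-Schwarz inequality an instance of the one for non-negative
  operators.\<close>

lemma nonneg_op_id: "nonneg_op (\<lambda>x. x)"
  unfolding nonneg_op_def bounded_clinear_op_def clinear_op_def
  by (auto simp: cinner_norm intro: exI[of _ 1])

lemma Cauchy_Schwarz_cinner: "cmod (cinner x y) \<le> norm x * norm (y::'a::complex_hilbert)"
proof -
  have "(cmod (cinner x y))\<^sup>2 \<le> (norm x * norm y)\<^sup>2"
    using nonneg_op_Cauchy_Schwarz[OF nonneg_op_id, of x y] by (simp add: cinner_norm power_mult_distrib)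
  then show ?thesis by (rule power2_le_imp_le) simp
qed

lemma bounded_bilinear_cinner: "bounded_bilinear (cinner :: 'a::complex_hilbert \<Rightarrow> 'a \<Rightarrow> complex)"
  by (intro bounded_bilinear.intro exI[of _ 1])
    (auto simp: cinner_simps scaleR_scaleC Cauchy_Schwarz_cinner scaleR_conv_of_real)

lemma bounded_bilinear_scaleC: "bounded_bilinear (scaleC :: complex \<Rightarrow> 'a::complex_hilbert \<Rightarrow> 'a)"
  by (intro bounded_bilinear.intro exI[of _ 1])
    (auto simp: scaleC_add_left scaleC_add_right scaleR_scaleC scaleC_scaleC norm_scaleC
       scaleR_conv_of_real mult.commute)

lemmas tendsto_cinner = bounded_bilinear.tendsto[OF bounded_bilinear_cinner]
lemmas tendsto_scaleC = bounded_bilinear.tendsto[OF bounded_bilinear_scaleC]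

text \<open>Cauchy-Schwarz for the pair \<open>T x\<close>, \<open>x\<close> bounds the fourth power
  of \<open>norm (T x)\<close> by a product with the vanishing factor.\<close>

lemma nonneg_op_kernel:
  assumes T: "nonneg_op T" and "Re (cinner x (T x)) = 0"
  shows "T x = 0"
proof -
  have "(cmod (cinner (T x) (T x)))\<^sup>2 \<le> 0"
    using nonneg_op_Cauchy_Schwarz[OF T, of "T x" x] assms(2) by simp
  then show ?thesis by (simp add: cinner_norm)
qed

text \<open>A form bound becomes a norm bound: apply Cauchy-Schwarz to \<open>T x\<close> and
  \<open>x\<close>, bound both factors, and cancel the square of \<open>norm (T x)\<close>.\<close>

lemma nonneg_op_norm_le:
  assumes T: "nonneg_op T" and c: "c \<ge> 0"
    and le: "\<And>x. Re (cinner x (T x)) \<le> c * (norm x)\<^sup>2"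
  shows "norm (T x) \<le> c * norm x"
proof -
  have "((norm (T x))\<^sup>2)\<^sup>2 \<le> Re (cinner (T x) (T (T x))) * Re (cinner x (T x))"
    using nonneg_op_Cauchy_Schwarz[OF T, of "T x" x] by (simp add: cinner_norm norm_power)
  also have "\<dots> \<le> (c * (norm (T x))\<^sup>2) * (c * (norm x)\<^sup>2)"
    using T c by (intro mult_mono le) (auto simp: nonneg_op_def)
  finally have *: "(norm (T x))\<^sup>2 * (norm (T x))\<^sup>2 \<le> (norm (T x))\<^sup>2 * (c * norm x)\<^sup>2"
    by (simp add: power2_eq_square mult_ac)
  show ?thesis
  proof (cases "T x = 0")
    case False
    then have "(norm (T x))\<^sup>2 \<le> (c * norm x)\<^sup>2"
      using mult_le_cancel_left_pos[THEN iffD1, OF _ *] by simp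
    then show ?thesis by (rule power2_le_imp_le) (use c in simp)
  qed (use c in simp)
qed

section \<open>The square root of a non-negative operator\<close>

text \<open>With \<open>A = 1 - V\<close>, the fixed point \<open>Y\<close> of \<open>Y = (A + Y\<^sup>2)/2\<close> gives \<open>(1 - Y)\<^sup>2 = V\<close>. Since the iterates
commute, their increments are dominated in norm by those of the scalar iteration with \<open>A = 1\<close>, which
is monotone and bounded by 1.\<close>

primrec sqrt_iter :: "('a::complex_hilbert \<Rightarrow> 'a) \<Rightarrow> nat \<Rightarrow> 'a \<Rightarrow> 'a" where
  "sqrt_iter A 0 = (\<lambda>x. 0)"
| "sqrt_iter A (Suc n) = (\<lambda>x. (1/2) *\<^sub>C (A x + sqrt_iter A n (sqrt_iter A n x)))"

primrec sqrt_iter_bound :: "nat \<Rightarrow> real" where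
  "sqrt_iter_bound 0 = 0"
| "sqrt_iter_bound (Suc n) = (1 + (sqrt_iter_bound n)\<^sup>2) / 2"

lemma sqrt_iter_bound_range: "0 \<le> sqrt_iter_bound n \<and> sqrt_iter_bound n \<le> 1"
  by (induction n) (auto simp: power_le_one)

lemma sqrt_iter_bound_convergent: "convergent sqrt_iter_bound"
proof -
  \<comment> \<open>The increment is half of the square of
    \<open>1 - sqrt_iter_bound n\<close>.\<close>
  have "sqrt_iter_bound n \<le> sqrt_iter_bound (Suc n)" for n
    using zero_le_power2[of "1 - sqrt_iter_bound n"]
    by (simp add: power2_eq_square algebra_simps)
  then have "incseq sqrt_iter_bound" by (rule incseq_SucI)
  then obtain L where "sqrt_iter_bound \<longlonglongrightarrow> L"
    using incseq_convergent[of sqrt_iter_bound 1] sqrt_iter_bound_range by blast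
  then show ?thesis by (rule convergentI)
qed

lemma clinear_op_sqrt_iter: "clinear_op A \<Longrightarrow> clinear_op (sqrt_iter A n)"
  by (induction n) (auto simp: clinear_op_def scaleC_add_right scaleC_scaleC mult.commute)

text \<open>The iterates are polynomials in \<open>A\<close>. In the limit this lets the square root
  commute with everything that commutes with \<open>A\<close>, which is what uniqueness rests
  on.\<close>

lemma sqrt_iter_commute:
  assumes B: "clinear_op B" and BA: "\<And>x. B (A x) = A (B x)"
  shows "B (sqrt_iter A n x) = sqrt_iter A n (B x)"
proof (induction n arbitrary: x)
  case 0
  show ?case using B clinear_op_diff[OF B, of 0 0] by simp
next
  case (Suc n)
  then show ?case using B BA by (simp add: clinear_op_def)
qed

lemma sqrt_iter_commute_sqrt_iter:
  assumes A: "clinear_op A"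
  shows "sqrt_iter A n (sqrt_iter A m x) = sqrt_iter A m (sqrt_iter A n x)"
  using A by (intro sqrt_iter_commute clinear_op_sqrt_iter)
    (auto intro: sqrt_iter_commute[symmetric])

lemma norm_sqrt_iter_le:
  assumes A: "\<And>x. norm (A x) \<le> norm x"
  shows "norm (sqrt_iter A n x) \<le> sqrt_iter_bound n * norm x"
proof (induction n arbitrary: x)
  case (Suc n)
  have "norm (sqrt_iter A n (sqrt_iter A n x)) \<le> sqrt_iter_bound n * norm (sqrt_iter A n x)"
    by (rule Suc)
  also have "\<dots> \<le> sqrt_iter_bound n * (sqrt_iter_bound n * norm x)"
    using sqrt_iter_bound_range by (intro mult_left_mono Suc) auto
  finally have "norm (A x + sqrt_iter A n (sqrt_iter A n x))
      \<le> norm x + sqrt_iter_bound n * (sqrt_iter_bound n * norm x)"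
    using A[of x] by (intro order_trans[OF norm_triangle_ineq] add_mono)
  then show ?case
    by (simp add: norm_scaleC power2_eq_square algebra_simps)
qed simp

text \<open>Commuting iterates allow the factorization of a difference of squares into difference
  times sum. The scalar sequence satisfies the same recursion, so both factors are bounded by their
  scalar counterparts.\<close>

lemma norm_sqrt_iter_diff_le:
  assumes lin: "clinear_op A" and A: "\<And>x. norm (A x) \<le> norm x"
  shows "norm (sqrt_iter A (Suc n) x - sqrt_iter A n x)
    \<le> (sqrt_iter_bound (Suc n) - sqrt_iter_bound n) * norm x"
proof (induction n arbitrary: x)
  case 0
  then show ?case using A[of x] by (simp add: norm_scaleC)
next
  case (Suc n)
  let ?Y = "sqrt_iter A" and ?y = sqrt_iter_bound
  have add: "?Y n (x + y) = ?Y n x + ?Y n y" for n x y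
    using clinear_op_sqrt_iter[OF lin] by (simp add: clinear_op_def)
  have nonneg: "0 \<le> ?y (Suc n) - ?y n"
    using zero_le_power2[of "1 - ?y n"] by (simp add: power2_eq_square algebra_simps)
  \<comment> \<open>Applying the difference of two consecutive iterates to \<open>w\<close> produces
    the difference of their squares at \<open>x\<close>.\<close>
  define w where "w = ?Y (Suc n) x + ?Y n x"
  have w: "norm w \<le> (?y (Suc n) + ?y n) * norm x"
    unfolding w_def distrib_right
    by (intro norm_triangle_le add_mono norm_sqrt_iter_le A)
  have Y_Suc: "?Y (Suc m) x = (1/2) *\<^sub>C (A x + ?Y m (?Y m x))" for m by simp
  have "?Y (Suc (Suc n)) x - ?Y (Suc n) x
      = (1/2) *\<^sub>C (A x + ?Y (Suc n) (?Y (Suc n) x)) - (1/2) *\<^sub>C (A x + ?Y n (?Y n x))"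
    by (rule arg_cong2[OF Y_Suc Y_Suc])
  also have "\<dots> = (1/2) *\<^sub>C (?Y (Suc n) (?Y (Suc n) x) - ?Y n (?Y n x))"
    by (simp only: scaleC_diff_right[symmetric] add_diff_cancel_left)
  also have "\<dots> = (1/2) *\<^sub>C (?Y (Suc n) w - ?Y n w)"
    using sqrt_iter_commute_sqrt_iter[OF lin, of "Suc n" n x] unfolding w_def add by (simp del: sqrt_iter.simps)
  finally have "norm (?Y (Suc (Suc n)) x - ?Y (Suc n) x) = 1/2 * norm (?Y (Suc n) w - ?Y n w)"
    by (simp add: norm_scaleC del: sqrt_iter.simps)
  also have "\<dots> \<le> 1/2 * ((?y (Suc n) - ?y n) * norm w)"
    using Suc[of w] by linarith
  also have "\<dots> \<le> 1/2 * ((?y (Suc n) - ?y n) * ((?y (Suc n) + ?y n) * norm x))"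
    using w nonneg by (intro mult_left_mono) auto
  also have "\<dots> = ((1 + (?y (Suc n))\<^sup>2) / 2 - (1 + (?y n)\<^sup>2) / 2) * norm x"
    by (simp add: power2_eq_square field_simps del: sqrt_iter_bound.simps)
  also have "\<dots> = (?y (Suc (Suc n)) - ?y (Suc n)) * norm x"
    by simp
  finally show ?case .
qed

lemma sqrt_iter_symmetric:
  assumes sym: "\<And>x y. cinner (A x) y = cinner x (A y)"
  shows "cinner (sqrt_iter A n x) y = cinner x (sqrt_iter A n y)"
  by (induction n arbitrary: x y) (auto simp: cinner_simps sym)

section \<open>Convergence by domination of increments, and existence of the square root\<close>

lemma norm_diff_le_of_step_le:
  fixes f :: "nat \<Rightarrow> 'a::real_normed_vector"
  assumes "\<And>n. norm (f (Suc n) - f n) \<le> g (Suc n) - g n"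
  shows "m \<le> n \<Longrightarrow> norm (f n - f m) \<le> g n - g m"
proof (induction n rule: nat_induct_at_least)
  case (Suc n)
  have "f (Suc n) - f m = (f (Suc n) - f n) + (f n - f m)" by simp
  then have "norm (f (Suc n) - f m) \<le> norm (f (Suc n) - f n) + norm (f n - f m)"
    by (metis norm_triangle_ineq)
  then show ?case using assms[of n] Suc by linarith
qed simp

lemma Cauchy_of_step_le:
  fixes f :: "nat \<Rightarrow> 'a::real_normed_vector"
  assumes step: "\<And>n. norm (f (Suc n) - f n) \<le> g (Suc n) - g n" and g: "convergent g"
  shows "Cauchy f"
proof (rule metric_CauchyI)
  fix e :: real assume "e > 0"
  then obtain M where M: "\<And>m n. m \<ge> M \<Longrightarrow> n \<ge> M \<Longrightarrow> dist (g m) (g n) < e"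
    using metric_CauchyD[OF convergent_Cauchy[OF g]] by blast
  have *: "dist (f m) (f n) < e" if "m \<ge> M" "n \<ge> M" "m \<le> n" for m n
    using norm_diff_le_of_step_le[of f g, OF step that(3)] M[OF that(1,2)]
    by (simp add: dist_norm norm_minus_commute)
  have "dist (f m) (f n) < e" if "m \<ge> M" "n \<ge> M" for m n
    using *[OF that] *[OF that(2,1)] by (cases "m \<le> n") (auto simp: dist_commute)
  then show "\<exists>M. \<forall>m\<ge>M. \<forall>n\<ge>M. dist (f m) (f n) < e" by blast
qed

text \<open>The operator is \<open>1 - Y\<close> for the strong limit \<open>Y\<close> of the
  iterates. The commutation clause survives the limit because \<open>B\<close> is continuous and
  commutes with every iterate.\<close>

lemma sqrt_of_one_minus_contraction:
  fixes A :: "'a::complex_hilbert \<Rightarrow> 'a"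
  assumes lin: "clinear_op A" and A: "\<And>x. norm (A x) \<le> norm x"
    and sym: "\<And>x y. cinner (A x) y = cinner x (A y)"
  obtains S where "nonneg_op S" "\<And>x. S (S x) = x - A x"
    "\<And>B x. bounded_clinear_op B \<Longrightarrow> (\<And>x. B (A x) = A (B x)) \<Longrightarrow> B (S x) = S (B x)"
proof -
  let ?Y = "sqrt_iter A"
  have "convergent (\<lambda>n. ?Y n x)" for x
  proof (rule Cauchy_convergent, rule Cauchy_of_step_le[where g = "\<lambda>n. sqrt_iter_bound n * norm x"])
    show "norm (?Y (Suc n) x - ?Y n x) \<le> sqrt_iter_bound (Suc n) * norm x - sqrt_iter_bound n * norm x" for n
      unfolding left_diff_distrib[symmetric] by (rule norm_sqrt_iter_diff_le[OF lin A])
    show "convergent (\<lambda>n. sqrt_iter_bound n * norm x)"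
      by (intro convergent_mult sqrt_iter_bound_convergent convergent_const)
  qed
  then obtain Y where Y: "\<And>x. (\<lambda>n. ?Y n x) \<longlonglongrightarrow> Y x"
    unfolding convergent_def by metis
  have le1: "norm (?Y n x) \<le> norm x" for n x
    using norm_sqrt_iter_le[OF A, of n x] sqrt_iter_bound_range[of n]
      mult_right_mono[of "sqrt_iter_bound n" 1 "norm x"] by simp
  have Yle: "norm (Y x) \<le> norm x" for x
    by (rule LIMSEQ_le_const2[OF tendsto_norm[OF Y]]) (auto simp: le1)
  have add_n: "?Y n (x + y) = ?Y n x + ?Y n y" and sc_n: "?Y n (a *\<^sub>C x) = a *\<^sub>C ?Y n x" for n a x y
    using clinear_op_sqrt_iter[OF lin] by (auto simp: clinear_op_def)
  have dif_n: "?Y n (x - y) = ?Y n x - ?Y n y" for n x y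
    using clinear_op_sqrt_iter[OF lin] by (rule clinear_op_diff)
  have add: "Y (x + y) = Y x + Y y" for x y
    using tendsto_add[OF Y[of x] Y[of y]] Y[of "x + y"] by (auto simp: add_n intro: LIMSEQ_unique)
  have sc: "Y (a *\<^sub>C x) = a *\<^sub>C Y x" for a x
    using tendsto_scaleC[OF tendsto_const Y[of x], of a] Y[of "a *\<^sub>C x"]
    by (auto simp: sc_n intro: LIMSEQ_unique)
  have linY: "clinear_op Y" using add sc by (simp add: clinear_op_def)
  have symY: "cinner (Y x) y = cinner x (Y y)" for x y
  proof (rule LIMSEQ_unique)
    show "(\<lambda>n. cinner (?Y n x) y) \<longlonglongrightarrow> cinner (Y x) y"
      by (rule tendsto_cinner[OF Y tendsto_const])
    show "(\<lambda>n. cinner (?Y n x) y) \<longlonglongrightarrow> cinner x (Y y)"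
      unfolding sqrt_iter_symmetric[of A, OF sym] by (rule tendsto_cinner[OF tendsto_const Y])
  qed
  \<comment> \<open>Both occurrences of the iterate vary with \<open>n\<close>. Since every iterate
    is a contraction, replacing the inner one by its limit costs at most
    \<open>norm (?Y n x - Y x)\<close>.\<close>
  have YY: "(\<lambda>n. ?Y n (?Y n x)) \<longlonglongrightarrow> Y (Y x)" for x
  proof (rule Lim_transform)
    show "(\<lambda>n. ?Y n (Y x)) \<longlonglongrightarrow> Y (Y x)" by (rule Y)
    have "(\<lambda>n. norm (?Y n x - Y x)) \<longlonglongrightarrow> 0"
      using tendsto_norm[OF tendsto_diff[OF Y[of x] tendsto_const, of "Y x"]] by simp
    then show "(\<lambda>n. ?Y n (?Y n x) - ?Y n (Y x)) \<longlonglongrightarrow> 0"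
      by (rule Lim_null_comparison[rotated]) (simp add: dif_n[symmetric] le1)
  qed
  have fixY: "Y x = (1/2) *\<^sub>C (A x + Y (Y x))" for x
  proof (rule LIMSEQ_unique)
    show "(\<lambda>n. ?Y (Suc n) x) \<longlonglongrightarrow> Y x" by (rule LIMSEQ_Suc[OF Y])
    show "(\<lambda>n. ?Y (Suc n) x) \<longlonglongrightarrow> (1/2) *\<^sub>C (A x + Y (Y x))"
      by (simp, intro tendsto_scaleC tendsto_const tendsto_add YY)
  qed
  define S where "S x = x - Y x" for x
  have "nonneg_op S"
    unfolding nonneg_op_def bounded_clinear_op_def
  proof (intro conjI allI)
    show "clinear_op S" using linY by (simp add: S_def clinear_op_def scaleC_diff_right)
    have "norm (S x) \<le> norm x * 2" for x
      using norm_triangle_ineq4[of x "Y x"] Yle[of x] by (simp add: S_def)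
    then show "\<exists>K. \<forall>x. norm (S x) \<le> norm x * K" by blast
    fix x
    have "cnj (cinner x (Y x)) = cinner x (Y x)"
      by (metis cinner_commute symY)
    then show "Im (cinner x (S x)) = 0"
      by (simp add: S_def cinner_simps cinner_norm complex_eq_iff)
    \<comment> \<open>\<open>1 - Y\<close> is non-negative because \<open>Y\<close> is a
      contraction.\<close>
    have "Re (cinner x (Y x)) \<le> norm x * norm (Y x)"
      using complex_Re_le_cmod Cauchy_Schwarz_cinner order_trans by blast
    also have "\<dots> \<le> norm x * norm x" by (intro mult_left_mono Yle) simp
    finally show "0 \<le> Re (cinner x (S x))"
      by (simp add: S_def cinner_simps cinner_norm power2_eq_square)
  qed
  moreover have "S (S x) = x - A x" for x
  proof -
    have "2 *\<^sub>C Y x = A x + Y (Y x)"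
      by (subst fixY) (simp add: scaleC_scaleC scaleC_one)
    moreover have "2 *\<^sub>C Y x = Y x + Y x"
      using scaleC_add_left[of 1 1 "Y x"] by (simp add: scaleC_one)
    ultimately have "Y x + Y x = A x + Y (Y x)" by simp
    then show ?thesis by (simp add: S_def clinear_op_diff[OF linY] algebra_simps)
  qed
  moreover have "B (S x) = S (B x)"
    if B: "bounded_clinear_op B" and BA: "\<And>x. B (A x) = A (B x)" for B x
  proof -
    have linB: "clinear_op B" using B by (simp add: bounded_clinear_op_def)
    have "(\<lambda>n. B (?Y n x)) \<longlonglongrightarrow> B (Y x)"
      by (rule bounded_linear.tendsto[OF bounded_clinear_op_bounded_linear[OF B] Y])
    then have "B (Y x) = Y (B x)"
      using Y[of "B x"] by (simp add: sqrt_iter_commute[of B A, OF linB BA] LIMSEQ_unique)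
    then show ?thesis by (simp add: S_def clinear_op_diff[OF linB])
  qed
  ultimately show ?thesis using that by blast
qed

text \<open>Dividing by a norm bound \<open>K\<close> reduces to the previous lemma with
  \<open>A\<close> equal to \<open>1 - V/K\<close>; multiplying the resulting root by
  \<open>sqrt K\<close> undoes the scaling.\<close>

lemma nonneg_op_sqrt_exists:
  fixes V :: "'a::complex_hilbert \<Rightarrow> 'a"
  assumes V: "nonneg_op V"
  obtains S where "nonneg_op S" "S \<circ> S = V"
    "\<And>B x. bounded_clinear_op B \<Longrightarrow> (\<And>x. B (V x) = V (B x)) \<Longrightarrow> B (S x) = S (B x)"
proof -
  obtain K where K: "K > 0" "\<And>x. norm (V x) \<le> norm x * K"
    using bounded_linear.pos_bounded[OF nonneg_op_bounded_linear[OF V]] by blast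
  define A where "A x = x - complex_of_real (1/K) *\<^sub>C V x" for x
  have linV: "clinear_op V" using V by (rule nonneg_op_clinear)
  have linA: "clinear_op A"
    using linV by (simp add: A_def clinear_op_def scaleC_add_right scaleC_diff_right scaleC_scaleC mult.commute)
  have inner: "cinner x (A x) = complex_of_real ((norm x)\<^sup>2 - Re (cinner x (V x)) / K)" for x
    using V K(1) by (simp add: A_def cinner_simps cinner_norm complex_eq_iff nonneg_op_def)
  have Vpos: "0 \<le> Re (cinner x (V x))" for x
    using V by (simp add: nonneg_op_def)
  have Vle: "Re (cinner x (V x)) \<le> K * (norm x)\<^sup>2" for x
  proof -
    have "Re (cinner x (V x)) \<le> norm x * norm (V x)"
      using complex_Re_le_cmod Cauchy_Schwarz_cinner order_trans by blast
    also have "\<dots> \<le> norm x * (norm x * K)" by (intro mult_left_mono K) simp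
    finally show ?thesis by (simp only: power2_eq_square mult_ac)
  qed
  have A: "nonneg_op A"
    unfolding nonneg_op_def bounded_clinear_op_def
  proof (intro conjI allI linA)
    have "norm (A x) \<le> norm x * 2" for x
    proof -
      have "norm (A x) \<le> norm x + 1/K * norm (V x)"
        using norm_triangle_ineq4[of x "complex_of_real (1/K) *\<^sub>C V x"] K(1)
        by (simp add: A_def norm_scaleC norm_divide)
      also have "\<dots> \<le> norm x + 1/K * (norm x * K)"
        using K by (intro add_left_mono mult_left_mono) auto
      finally show ?thesis using K(1) by simp
    qed
    then show "\<exists>K. \<forall>x. norm (A x) \<le> norm x * K" by blast
    show "Im (cinner x (A x)) = 0" "0 \<le> Re (cinner x (A x))" for x
      using Vle[of x] K(1) by (auto simp: inner field_simps)
  qed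
  \<comment> \<open>The form of \<open>A\<close> lies between 0 and that of the identity, so the
    form bound with constant 1 gives a contraction.\<close>
  have "norm (A x) \<le> norm x" for x
    using nonneg_op_norm_le[OF A, of 1 x] Vpos K(1) by (simp add: inner)
  then obtain S where S: "nonneg_op S" "\<And>x. S (S x) = x - A x"
    and comm: "\<And>B x. bounded_clinear_op B \<Longrightarrow> (\<And>x. B (A x) = A (B x)) \<Longrightarrow> B (S x) = S (B x)"
    using sqrt_of_one_minus_contraction[OF linA _ nonneg_op_symmetric[OF A]] by blast
  have linS: "clinear_op S" using S(1) by (rule nonneg_op_clinear)
  define T where "T x = complex_of_real (sqrt K) *\<^sub>C S x" for x
  have "nonneg_op T"
    unfolding nonneg_op_def bounded_clinear_op_def
  proof (intro conjI allI)
    show "clinear_op T"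
      using linS by (simp add: T_def clinear_op_def scaleC_add_right scaleC_scaleC mult.commute)
    obtain C where "\<And>x. norm (S x) \<le> norm x * C"
      using S(1) by (auto simp: nonneg_op_def bounded_clinear_op_def)
    then have "norm (T x) \<le> norm x * (sqrt K * C)" for x
      using K(1) by (simp add: T_def norm_scaleC mult_left_mono mult.left_commute)
    then show "\<exists>K. \<forall>x. norm (T x) \<le> norm x * K" by blast
    show "Im (cinner x (T x)) = 0" "0 \<le> Re (cinner x (T x))" for x
      using S(1) K(1) by (auto simp: T_def cinner_simps nonneg_op_def)
  qed
  moreover have "T \<circ> T = V"
  proof
    fix x
    have "(T \<circ> T) x = (complex_of_real (sqrt K) * complex_of_real (sqrt K)) *\<^sub>C S (S x)"
      using linS by (simp add: T_def clinear_op_def scaleC_scaleC)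
    also have "\<dots> = V x"
      using K(1) by (simp add: S A_def scaleC_scaleC scaleC_one flip: of_real_mult)
    finally show "(T \<circ> T) x = V x" .
  qed
  moreover have "B (T x) = T (B x)"
    if B: "bounded_clinear_op B" and BV: "\<And>x. B (V x) = V (B x)" for B x
  proof -
    have linB: "clinear_op B" using B by (simp add: bounded_clinear_op_def)
    have "B (A x) = A (B x)" for x
      using linB BV by (simp add: A_def clinear_op_diff[OF linB]) (simp add: clinear_op_def)
    then show ?thesis
      using comm[OF B] linB by (simp add: T_def clinear_op_def)
  qed
  ultimately show ?thesis using that by blast
qed

text \<open>For \<open>y = S x - T x\<close>, commutation gives \<open>S y + T y = 0\<close>. Both
  forms are non-negative and so vanish at \<open>y\<close>, hence \<open>S\<close> and
  \<open>T\<close> kill \<open>y\<close>, and by symmetry \<open>y\<close> is orthogonal to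
  \<open>S x - T x\<close>, which is \<open>y\<close> itself.\<close>

lemma nonneg_op_sqrt_unique:
  assumes S: "nonneg_op S" and T: "nonneg_op T"
    and eq: "\<And>x. S (S x) = T (T x)" and comm: "\<And>x. T (S x) = S (T x)"
  shows "S = T"
proof
  fix x
  have dS: "S (x - y) = S x - S y" and dT: "T (x - y) = T x - T y" for x y
    using nonneg_op_clinear[OF S] nonneg_op_clinear[OF T] by (auto intro: clinear_op_diff)
  define y where "y = S x - T x"
  have "S y + T y = 0" by (simp add: y_def dS dT eq comm)
  then have "Re (cinner y (S y)) + Re (cinner y (T y)) = 0"
    by (metis cinner_add_right cinner_zero_right plus_complex.sel(1) zero_complex.sel(1))
  moreover have "Re (cinner y (S y)) \<ge> 0" "Re (cinner y (T y)) \<ge> 0"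
    using S T by (auto simp: nonneg_op_def)
  ultimately have "S y = 0" "T y = 0"
    using nonneg_op_kernel S T by (metis add_nonneg_eq_0_iff)+
  have "cinner y y = cinner (S x) y - cinner (T x) y"
    by (subst (1) y_def) (simp add: cinner_diff_left)
  also have "\<dots> = 0"
    using \<open>S y = 0\<close> \<open>T y = 0\<close> by (simp add: nonneg_op_symmetric[OF S] nonneg_op_symmetric[OF T])
  finally show "S x = T x" by (simp add: cinner_eq_0_iff y_def)
qed

text \<open>Discharges the definite description in \<open>op_sqrt\<close>. Any root \<open>T\<close>
  commutes with its square \<open>V\<close>, hence with the constructed root \<open>S\<close>, so
  the uniqueness lemma applies.\<close>

lemma op_sqrt_nonneg_square:
  assumes V: "nonneg_op V"
  shows "nonneg_op (op_sqrt V) \<and> op_sqrt V \<circ> op_sqrt V = V"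
proof -
  obtain S where S: "nonneg_op S" "S \<circ> S = V"
    and comm: "\<And>B x. bounded_clinear_op B \<Longrightarrow> (\<And>x. B (V x) = V (B x)) \<Longrightarrow> B (S x) = S (B x)"
    using nonneg_op_sqrt_exists[OF V] by blast
  show ?thesis
    unfolding op_sqrt_def
  proof (rule theI[of _ S])
    show "nonneg_op S \<and> S \<circ> S = V" using S by simp
    fix T assume T: "nonneg_op T \<and> T \<circ> T = V"
    have "T (S x) = S (T x)" for x
      using T by (intro comm) (auto simp: nonneg_op_def)
    moreover have "S (S x) = T (T x)" for x
      using S T by (metis comp_apply)
    ultimately show "T = S"
      using nonneg_op_sqrt_unique[of S T] S T by blast
  qed
qed

section \<open>Orthogonal projections and resolvents of self-adjoint operators\<close>

lemma norm_sq_cinner: "(norm (x::'a::complex_hilbert))\<^sup>2 = Re (cinner x x)"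
  by (simp add: cinner_norm)

lemma parallelogram_cinner:
  "(norm (x + y))\<^sup>2 + (norm (x - y))\<^sup>2 = 2 * (norm x)\<^sup>2 + 2 * (norm (y::'a::complex_hilbert))\<^sup>2"
  by (simp add: norm_sq_cinner cinner_simps)

lemma csubspace_diff: "csubspace M \<Longrightarrow> x \<in> M \<Longrightarrow> y \<in> M \<Longrightarrow> x - y \<in> M"
  unfolding csubspace_def by (metis add_uminus_conv_diff scaleC_minus_left scaleC_one)

text \<open>The projection theorem: a minimizing sequence for the distance from \<open>x\<close> to
  \<open>M\<close> is Cauchy, and its limit is orthogonal to \<open>M\<close> in the residual, as
  otherwise a small step inside \<open>M\<close> would come closer to \<open>x\<close>.\<close>

lemma orthogonal_decomposition:
  fixes M :: "'a::complex_hilbert set"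
  assumes M: "csubspace M" and cl: "closed M"
  obtains p where "p \<in> M" "\<And>m. m \<in> M \<Longrightarrow> cinner m (x - p) = 0"
proof -
  have ne: "M \<noteq> {}" using M by (auto simp: csubspace_def)
  define d where "d = infdist x M"
  have d0: "d \<ge> 0" by (simp add: d_def infdist_nonneg)
  have dle: "d \<le> norm (x - m)" if "m \<in> M" for m
    using infdist_le[OF that, of x] by (simp add: d_def dist_norm)
  have "\<exists>p\<in>M. norm (x - p) < d + inverse (real (Suc n))" for n
  proof -
    have "\<exists>a\<in>M. dist x a < infdist x M + inverse (real (Suc n))"
      unfolding infdist_notempty[OF ne]
      by (subst cINF_less_iff[symmetric]) (auto simp: ne intro!: bdd_belowI2[of _ 0])
    then show ?thesis by (simp add: d_def dist_norm)
  qed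
  then obtain p where p: "\<And>n. p n \<in> M" "\<And>n. norm (x - p n) < d + inverse (real (Suc n))"
    by metis
  have "(\<lambda>n. norm (x - p n)) \<longlonglongrightarrow> d"
  proof (rule tendsto_sandwich)
    show "(\<lambda>n. d) \<longlonglongrightarrow> d" by simp
    show "(\<lambda>n. d + inverse (real (Suc n))) \<longlonglongrightarrow> d"
      using tendsto_add[OF tendsto_const LIMSEQ_inverse_real_of_nat, of d] by simp
    show "\<forall>\<^sub>F n in sequentially. d \<le> norm (x - p n)"
      using dle p(1) by simp
    show "\<forall>\<^sub>F n in sequentially. norm (x - p n) \<le> d + inverse (real (Suc n))"
      using p(2) less_imp_le by (intro always_eventually) blast
  qed
  note lim = this
  have "Cauchy p"
  proof (rule metric_CauchyI)
    fix e :: real assume e: "e > 0"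
    have "(\<lambda>n. (norm (x - p n))\<^sup>2) \<longlonglongrightarrow> d\<^sup>2" by (intro tendsto_power lim)
    moreover have "d\<^sup>2 < d\<^sup>2 + e\<^sup>2/4" using e by simp
    ultimately have "\<forall>\<^sub>F n in sequentially. (norm (x - p n))\<^sup>2 < d\<^sup>2 + e\<^sup>2/4"
      by (rule order_tendstoD(2))
    then obtain N where N: "\<And>n. n \<ge> N \<Longrightarrow> (norm (x - p n))\<^sup>2 < d\<^sup>2 + e\<^sup>2/4"
      by (auto simp: eventually_sequentially)
    have "dist (p m) (p n) < e" if "m \<ge> N" "n \<ge> N" for m n
    proof -
      \<comment> \<open>The midpoint \<open>u\<close> lies in \<open>M\<close>, hence at distance at
        least \<open>d\<close> from \<open>x\<close>. The parallelogram law then leaves at most four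
        times the excess \<open>e\<^sup>2/4\<close> for the squared distance of \<open>p m\<close>
        and \<open>p n\<close>.\<close>
      define u where "u = (1/2) *\<^sub>C (p m + p n)"
      have "u \<in> M" using M p(1) by (simp add: u_def csubspace_def)
      then have "d\<^sup>2 \<le> (norm (x - u))\<^sup>2" using dle d0 by (simp add: power_mono)
      moreover have "(x - p m) + (x - p n) = 2 *\<^sub>C (x - u)"
        using scaleC_add_left[of 1 1 x]
        by (simp add: u_def scaleC_diff_right scaleC_scaleC scaleC_one)
      then have "(norm ((x - p m) + (x - p n)))\<^sup>2 = 4 * (norm (x - u))\<^sup>2"
        by (simp add: norm_scaleC power_mult_distrib)
      moreover have "(x - p m) - (x - p n) = p n - p m" by simp
      ultimately have "(norm (p n - p m))\<^sup>2 < e\<^sup>2"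
        using parallelogram_cinner[of "x - p m" "x - p n"] N[OF that(1)] N[OF that(2)] by simp
      then have "norm (p n - p m) < e"
        by (rule power2_less_imp_less) (use e in simp)
      then show ?thesis by (simp add: dist_norm norm_minus_commute)
    qed
    then show "\<exists>M. \<forall>m\<ge>M. \<forall>n\<ge>M. dist (p m) (p n) < e" by blast
  qed
  then obtain q where q: "p \<longlonglongrightarrow> q"
    using Cauchy_convergent convergent_def by blast
  have qM: "q \<in> M" using closed_sequentially[OF cl _ q] p(1) by blast
  have "(\<lambda>n. norm (x - p n)) \<longlonglongrightarrow> norm (x - q)" by (intro tendsto_intros q)
  then have qd: "norm (x - q) = d" using lim LIMSEQ_unique by blast
  have "cinner m (x - q) = 0" if m: "m \<in> M" for m
  proof (rule ccontr)
    define b where "b = cinner m (x - q)"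
    assume "cinner m (x - q) \<noteq> 0"
    then have b0: "(cmod b)\<^sup>2 > 0" by (simp add: b_def)
    \<comment> \<open>A step length with \<open>s * (norm m)\<^sup>2 < 2\<close>, so that moving
      from \<open>q\<close> by \<open>c *\<^sub>C m\<close> strictly decreases the distance; the
      added 1 covers \<open>m = 0\<close>.\<close>
    define s where "s = 1 / ((norm m)\<^sup>2 + 1)"
    have s: "s > 0" and s1: "s * (norm m)\<^sup>2 < 2"
      using add_nonneg_pos[of "(norm m)\<^sup>2" 1] by (auto simp: s_def field_simps)
    define c where "c = complex_of_real s * b"
    have "q + c *\<^sub>C m \<in> M" using M m qM by (simp add: csubspace_def)
    then have "d\<^sup>2 \<le> (norm ((x - q) - c *\<^sub>C m))\<^sup>2"
      using dle d0 by (metis diff_diff_add power_mono)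
    also have "\<dots> = (norm (x - q))\<^sup>2 - 2 * s * (cmod b)\<^sup>2 + s\<^sup>2 * (cmod b)\<^sup>2 * (norm m)\<^sup>2"
    proof -
      have "cinner (x - q) m = cnj b" unfolding b_def by (rule cinner_commute)
      then have "(norm ((x - q) - c *\<^sub>C m))\<^sup>2
          = (norm (x - q))\<^sup>2 - Re (c * cnj b) - Re (cnj c * b) + Re (cnj c * c) * (norm m)\<^sup>2"
        unfolding norm_sq_cinner[of "(x - q) - c *\<^sub>C m"] cinner_diff_left[of "x - q"]
          cinner_diff_right[of _ "x - q"] cinner_scaleC_left cinner_scaleC_right b_def[symmetric]
        by (simp add: cinner_norm algebra_simps)
      also have "\<dots> = (norm (x - q))\<^sup>2 - 2 * s * (cmod b)\<^sup>2 + s\<^sup>2 * (cmod b)\<^sup>2 * (norm m)\<^sup>2"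
        by (simp add: c_def cmod_power2) (simp add: power2_eq_square algebra_simps)
      finally show ?thesis .
    qed
    finally have "0 \<le> (cmod b)\<^sup>2 * (s * (s * (norm m)\<^sup>2 - 2))"
      using qd by (simp add: power2_eq_square algebra_simps)
    moreover have "s * (s * (norm m)\<^sup>2 - 2) < 0"
      using s s1 by (simp add: mult_less_0_iff)
    ultimately show False using mult_pos_neg[OF b0] by fastforce
  qed
  then show ?thesis using that qM by blast
qed

text \<open>A closed subspace equals its double orthogonal complement. In this form it shows below
  that \<open>H0 - z\<close> is surjective and that certain vectors are weakly asymptotically
  orthogonal to a family.\<close>

lemma closed_csubspace_memI:
  assumes M: "csubspace M" "closed M"
    and orth: "\<And>q. (\<And>m. m \<in> M \<Longrightarrow> cinner m q = 0) \<Longrightarrow> cinner q x = 0"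
  shows "x \<in> M"
proof -
  obtain p where p: "p \<in> M" "\<And>m. m \<in> M \<Longrightarrow> cinner m (x - p) = 0"
    using orthogonal_decomposition[OF M] by blast
  have "cinner (x - p) x = 0" using orth p(2) by blast
  moreover have "cinner (x - p) p = 0"
    using p cinner_commute[of "x - p" p] by simp
  ultimately have "cinner (x - p) (x - p) = 0"
    by (simp only: cinner_diff_right[of "x - p"] diff_zero)
  then show ?thesis using p(1) by (simp add: cinner_eq_0_iff)
qed

lemma oproj_eqI:
  assumes M: "csubspace M" and p: "p \<in> M" and orth: "\<And>m. m \<in> M \<Longrightarrow> cinner m (x - p) = 0"
  shows "oproj M x = p"
  unfolding oproj_def
proof (rule the_equality)
  fix q assume q: "q \<in> M \<and> (\<forall>m\<in>M. cinner m (x - q) = 0)"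
  have "q - p \<in> M" using M p q by (simp add: csubspace_diff)
  then have "cinner (q - p) (x - p) = 0" "cinner (q - p) (x - q) = 0"
    using orth q by auto
  then have "cinner (q - p) (q - p) = 0"
    by (simp add: cinner_simps)
  then show "q = p" by (simp add: cinner_eq_0_iff)
qed (use p orth in auto)

section \<open>Self-adjoint operators: closed graph, surjectivity of \<open>A - z\<close>, and the
  resolvent\<close>

context
  fixes D :: "'a::complex_hilbert set" and A :: "'a \<Rightarrow> 'a"
  assumes sa: "self_adjoint_op D A"
begin

lemma sa_csubspace: "csubspace D"
  and sa_add: "x \<in> D \<Longrightarrow> y \<in> D \<Longrightarrow> A (x + y) = A x + A y"
  and sa_scaleC: "x \<in> D \<Longrightarrow> A (a *\<^sub>C x) = a *\<^sub>C A x"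
  and sa_adjointD: "(\<And>x. x \<in> D \<Longrightarrow> cinner (A x) y = cinner x z) \<Longrightarrow> y \<in> D \<and> A y = z"
  and sa_symmetric: "x \<in> D \<Longrightarrow> y \<in> D \<Longrightarrow> cinner (A x) y = cinner x (A y)"
  using sa unfolding self_adjoint_op_def by metis+

lemma sa_dom_scaleC: "x \<in> D \<Longrightarrow> a *\<^sub>C x \<in> D"
  and sa_dom_add: "x \<in> D \<Longrightarrow> y \<in> D \<Longrightarrow> x + y \<in> D"
  using sa_csubspace by (auto simp: csubspace_def)

lemma sa_dom_diff: "x \<in> D \<Longrightarrow> y \<in> D \<Longrightarrow> x - y \<in> D"
  using sa_csubspace by (rule csubspace_diff)

lemma sa_diff:
  assumes "x \<in> D" "y \<in> D"
  shows "A (x - y) = A x - A y"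
  using sa_add[OF sa_dom_diff[OF assms] assms(2)] by (simp add: eq_diff_eq)

lemma sa_Im_zero: "x \<in> D \<Longrightarrow> Im (cinner x (A x)) = 0"
proof -
  assume "x \<in> D"
  then have "cnj (cinner x (A x)) = cinner x (A x)"
    by (metis cinner_commute sa_symmetric)
  then show ?thesis by (simp add: complex_eq_iff)
qed

text \<open>Symmetry passes to the limit, and the limit identity is the criterion for membership in
  the adjoint's graph.\<close>

lemma sa_closed_graph:
  assumes "\<And>n. f n \<in> D" "f \<longlonglongrightarrow> x" "(\<lambda>n. A (f n)) \<longlonglongrightarrow> w"
  shows "x \<in> D \<and> A x = w"
proof (rule sa_adjointD)
  fix u assume u: "u \<in> D"
  have "(\<lambda>n. cinner (A u) (f n)) \<longlonglongrightarrow> cinner (A u) x"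
    by (intro tendsto_cinner tendsto_const assms)
  moreover have "(\<lambda>n. cinner u (A (f n))) \<longlonglongrightarrow> cinner u w"
    by (intro tendsto_cinner tendsto_const assms)
  ultimately show "cinner (A u) x = cinner u w"
    using sa_symmetric[OF u assms(1)] LIMSEQ_unique by simp
qed

text \<open>The form of \<open>A\<close> is real, so the imaginary part of
  \<open>cinner x (A x - z *\<^sub>C x)\<close> comes from \<open>z\<close> alone.\<close>

lemma sa_norm_ge:
  assumes x: "x \<in> D"
  shows "\<bar>Im z\<bar> * norm x \<le> norm (A x - z *\<^sub>C x)"
proof (cases "x = 0")
  case False
  have "Im (cinner x (A x - z *\<^sub>C x)) = - Im z * (norm x)\<^sup>2"
    using sa_Im_zero[OF x] by (simp add: cinner_simps cinner_norm)
  then have "\<bar>Im z\<bar> * (norm x)\<^sup>2 = \<bar>Im (cinner x (A x - z *\<^sub>C x))\<bar>"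
    by (simp add: abs_mult)
  also have "\<dots> \<le> norm x * norm (A x - z *\<^sub>C x)"
    using abs_Im_le_cmod Cauchy_Schwarz_cinner order_trans by blast
  finally have "norm x * (\<bar>Im z\<bar> * norm x) \<le> norm x * norm (A x - z *\<^sub>C x)"
    by (simp add: power2_eq_square mult_ac)
  then show ?thesis using False by simp
qed simp

text \<open>The range of \<open>A - z\<close> is closed by the lower bound \<open>sa_norm_ge\<close>
  and the closed graph. Its orthogonal complement consists of eigenvectors at \<open>cnj z\<close>,
  which the same bound excludes.\<close>

lemma sa_range_shift:
  assumes z: "Im z \<noteq> 0"
  shows "\<exists>x\<in>D. A x - z *\<^sub>C x = y"
proof -
  define M where "M = (\<lambda>x. A x - z *\<^sub>C x) ` D"
  have "y \<in> M"
  proof (rule closed_csubspace_memI)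
    show "csubspace M"
      unfolding csubspace_def
    proof (intro conjI ballI allI)
      have "0 \<in> D" using sa_csubspace by (simp add: csubspace_def)
      then show "0 \<in> M"
        using sa_scaleC[of 0 0] by (auto simp: M_def image_iff intro!: bexI[of _ 0])
      fix u v a assume "u \<in> M" "v \<in> M"
      then obtain x y where xy: "x \<in> D" "y \<in> D" "u = A x - z *\<^sub>C x" "v = A y - z *\<^sub>C y"
        by (auto simp: M_def)
      then have "u + v = A (x + y) - z *\<^sub>C (x + y)"
        by (simp add: sa_add scaleC_add_right)
      then show "u + v \<in> M" using xy sa_dom_add by (auto simp: M_def)
    next
      fix u a assume "u \<in> M"
      then obtain x where x: "x \<in> D" "u = A x - z *\<^sub>C x" by (auto simp: M_def)
      then have "a *\<^sub>C u = A (a *\<^sub>C x) - z *\<^sub>C (a *\<^sub>C x)"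
        by (simp add: sa_scaleC scaleC_diff_right scaleC_scaleC mult.commute)
      then show "a *\<^sub>C u \<in> M" using x sa_dom_scaleC by (auto simp: M_def)
    qed
    show "closed M"
      unfolding closed_sequential_limits
    proof (intro allI impI, elim conjE)
      fix f l assume f: "\<forall>n. f n \<in> M" and l: "f \<longlonglongrightarrow> l"
      then obtain g where g: "\<And>n. g n \<in> D" "\<And>n. f n = A (g n) - z *\<^sub>C g n"
        unfolding M_def image_iff by metis
      have "Cauchy g"
      proof (rule metric_CauchyI)
        fix e :: real assume "e > 0"
        then have "\<bar>Im z\<bar> * e > 0" using z by simp
        then obtain N where N: "\<And>m n. m \<ge> N \<Longrightarrow> n \<ge> N \<Longrightarrow> dist (f m) (f n) < \<bar>Im z\<bar> * e"
          using metric_CauchyD[OF LIMSEQ_imp_Cauchy[OF l]] by blast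
        have "dist (g m) (g n) < e" if "m \<ge> N" "n \<ge> N" for m n
        proof -
          have "\<bar>Im z\<bar> * norm (g m - g n) \<le> norm (A (g m - g n) - z *\<^sub>C (g m - g n))"
            by (intro sa_norm_ge sa_dom_diff g)
          also have "A (g m - g n) - z *\<^sub>C (g m - g n) = f m - f n"
            using g by (simp add: sa_diff scaleC_diff_right)
          also have "norm \<dots> < \<bar>Im z\<bar> * e" using N[OF that] by (simp add: dist_norm)
          finally show ?thesis using z by (simp add: dist_norm)
        qed
        then show "\<exists>M. \<forall>m\<ge>M. \<forall>n\<ge>M. dist (g m) (g n) < e" by blast
      qed
      then obtain x where x: "g \<longlonglongrightarrow> x" using Cauchy_convergent convergent_def by blast
      have "(\<lambda>n. f n + z *\<^sub>C g n) \<longlonglongrightarrow> l + z *\<^sub>C x"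
        by (intro tendsto_add l tendsto_scaleC tendsto_const x)
      then have "(\<lambda>n. A (g n)) \<longlonglongrightarrow> l + z *\<^sub>C x" by (simp add: g)
      then have "x \<in> D \<and> A x = l + z *\<^sub>C x" using sa_closed_graph g(1) x by blast
      then show "l \<in> M" by (auto simp: M_def image_iff intro!: bexI[of _ x])
    qed
    fix q assume q: "\<And>m. m \<in> M \<Longrightarrow> cinner m q = 0"
    have "q \<in> D \<and> A q = cnj z *\<^sub>C q"
    proof (rule sa_adjointD)
      fix x assume "x \<in> D"
      then have "cinner (A x - z *\<^sub>C x) q = 0" using q by (simp add: M_def)
      then show "cinner (A x) q = cinner x (cnj z *\<^sub>C q)" by (simp add: cinner_simps)
    qed
    then have "q = 0" using sa_norm_ge[of q "cnj z"] z by (simp add: mult_le_0_iff)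
    then show "cinner q y = 0" by simp
  qed
  then show ?thesis by (auto simp: M_def)
qed

text \<open>Uniqueness for the description in \<open>resolvent\<close>, from the lower bound;
  existence is \<open>sa_range_shift\<close>.\<close>

lemma resolvent_eqI:
  assumes z: "Im z \<noteq> 0" and x: "x \<in> D" "A x - z *\<^sub>C x = y"
  shows "resolvent D A z y = x"
  unfolding resolvent_def
proof (rule the_equality)
  fix w assume w: "w \<in> D \<and> A w - z *\<^sub>C w = y"
  then have "A (w - x) - z *\<^sub>C (w - x) = 0"
    using x by (simp add: sa_diff scaleC_diff_right algebra_simps)
  then show "w = x"
    using sa_norm_ge[of "w - x" z] w x z sa_dom_diff by (simp add: mult_le_0_iff)
qed (use x in auto)

lemma resolvent_solves:
  assumes z: "Im z \<noteq> 0"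
  shows "resolvent D A z y \<in> D"
    and "A (resolvent D A z y) = y + z *\<^sub>C resolvent D A z y"
proof -
  obtain x where "x \<in> D" "A x - z *\<^sub>C x = y" using sa_range_shift[OF z] by blast
  then show "resolvent D A z y \<in> D" "A (resolvent D A z y) = y + z *\<^sub>C resolvent D A z y"
    using resolvent_eqI[OF z] by auto
qed

lemma norm_resolvent_le:
  assumes z: "Im z \<noteq> 0"
  shows "\<bar>Im z\<bar> * norm (resolvent D A z y) \<le> norm y"
  using sa_norm_ge[OF resolvent_solves(1)[OF z], of z y] resolvent_solves(2)[OF z, of y] by simp

end

section \<open>Boundary values and eigenvectors\<close>

text \<open>The uniform bound on \<open>r\<close> makes the error from replacing \<open>w\<close> by
  a nearby \<open>v\<close> small independently of the parameter.\<close>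

lemma closed_weakly_null:
  fixes r :: "'b \<Rightarrow> 'a::complex_hilbert"
  assumes bd: "\<forall>\<^sub>F e in F. norm (r e) \<le> C"
  shows "closed {w. ((\<lambda>e. cinner w (r e)) \<longlongrightarrow> 0) F}" (is "closed ?M")
proof -
  have "w \<in> ?M" if w: "w \<in> closure ?M" for w
  proof -
    have "((\<lambda>e. cinner w (r e)) \<longlongrightarrow> 0) F"
    proof (rule tendstoI)
      fix d :: real assume d: "d > 0"
      \<comment> \<open>Taking \<open>\<bar>C\<bar> + 1\<close> keeps the denominator positive for
        every \<open>C\<close>.\<close>
      define \<delta> where "\<delta> = d / (2 * (\<bar>C\<bar> + 1))"
      have \<delta>: "\<delta> > 0" using d by (simp add: \<delta>_def)
      then obtain v where v: "v \<in> ?M" "dist v w < \<delta>"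
        using w closure_approachable by blast
      have "\<forall>\<^sub>F e in F. dist (cinner v (r e)) 0 < d/2"
        using v(1) d by (intro tendstoD) auto
      with bd show "\<forall>\<^sub>F e in F. dist (cinner w (r e)) 0 < d"
      proof eventually_elim
        fix e assume e: "norm (r e) \<le> C" "dist (cinner v (r e)) 0 < d/2"
        have "cmod (cinner (w - v) (r e)) \<le> norm (w - v) * norm (r e)"
          by (rule Cauchy_Schwarz_cinner)
        also have "\<dots> \<le> \<delta> * (\<bar>C\<bar> + 1)"
          using v(2) e(1) \<delta> by (intro mult_mono) (auto simp: dist_norm norm_minus_commute)
        also have "\<dots> = d / 2" by (simp add: \<delta>_def field_simps)
        finally have "cmod (cinner (w - v) (r e)) \<le> d/2" .
        moreover have "cinner w (r e) = cinner (w - v) (r e) + cinner v (r e)"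
          by (simp add: cinner_simps)
        ultimately show "dist (cinner w (r e)) 0 < d"
          using e(2) norm_triangle_ineq[of "cinner (w - v) (r e)" "cinner v (r e)"] by simp
      qed
    qed
    then show ?thesis by simp
  qed
  then show ?thesis by (metis closure_subset_eq subsetI)
qed

lemma csubspace_weakly_null:
  "csubspace {w::'a::complex_hilbert. ((\<lambda>e. cinner w (r e)) \<longlongrightarrow> 0) F}"
  unfolding csubspace_def
  by (auto simp: cinner_simps intro: tendsto_add_zero tendsto_mult_right_zero)

section \<open>The square root of the perturbation\<close>

context
  fixes V :: "'a::complex_hilbert \<Rightarrow> 'a"
  assumes V: "nonneg_op V"
begin

lemma sqrt_nonneg: "nonneg_op (op_sqrt V)"
  and sqrt_square: "op_sqrt V (op_sqrt V x) = V x"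
  using op_sqrt_nonneg_square[OF V] by (auto simp: fun_eq_iff)

lemma sqrt_symmetric: "cinner (op_sqrt V x) y = cinner x (op_sqrt V y)"
  by (rule nonneg_op_symmetric[OF sqrt_nonneg])

lemma sqrt_kernel: "op_sqrt V x = 0 \<longleftrightarrow> V x = 0"
proof
  assume "op_sqrt V x = 0"
  then show "V x = 0"
    using sqrt_square[of x] nonneg_op_clinear[OF sqrt_nonneg] clinear_op_diff[of "op_sqrt V" 0 0] by simp
next
  assume "V x = 0"
  then have "cinner (op_sqrt V x) (op_sqrt V x) = 0"
    by (simp add: sqrt_symmetric sqrt_square)
  then show "op_sqrt V x = 0" by (simp add: cinner_eq_0_iff)
qed

end

lemma csubspace_HV: "csubspace (HV D H0 V)"
  unfolding HV_def csubspace_def reducing_subspace_def by auto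

context
  fixes D :: "'a::complex_hilbert set" and H0 V :: "'a \<Rightarrow> 'a"
  assumes sa: "self_adjoint_op D H0" and V: "nonneg_op V"
begin

text \<open>An eigenvector of \<open>H0\<close> at \<open>E\<close> that is not killed by \<open>V\<close> makes \<open>G (E + i\<epsilon>)\<close> blow up
  like \<open>1/\<epsilon>\<close>.\<close>

lemma eigenvector_killed_of_boundary_value:
  assumes \<eta>: "\<eta> \<in> D" "H0 \<eta> = complex_of_real E *\<^sub>C \<eta>"
    and lim: "((\<lambda>\<epsilon>. Gop D H0 V (complex_of_real E + \<i> * complex_of_real \<epsilon>) (op_sqrt V \<eta>)) \<longlongrightarrow> l) (at_right 0)"
  shows "op_sqrt V \<eta> = 0"
proof -
  let ?S = "op_sqrt V"
  let ?G = "\<lambda>\<epsilon>. Gop D H0 V (complex_of_real E + \<i> * complex_of_real \<epsilon>) (?S \<eta>)"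
  define q where "q = Re (cinner \<eta> (V \<eta>))"
  have q: "cinner \<eta> (V \<eta>) = complex_of_real q"
    using V by (simp add: q_def nonneg_op_def complex_eq_iff)
  have bound: "q\<^sup>2 \<le> \<epsilon> * ((norm \<eta>)\<^sup>2 * (norm (?S \<eta>) * norm (?G \<epsilon>)))" if \<epsilon>: "\<epsilon> > 0" for \<epsilon> :: real
  proof -
    define z where "z = complex_of_real E + \<i> * complex_of_real \<epsilon>"
    have z: "Im z \<noteq> 0" "Im z = \<epsilon>" "complex_of_real E - z = - \<i> * complex_of_real \<epsilon>"
      using \<epsilon> by (auto simp: z_def)
    define w where "w = resolvent D H0 z (V \<eta>)"
    have w: "w \<in> D" "H0 w = V \<eta> + z *\<^sub>C w"
      using resolvent_solves[OF sa z(1)] by (auto simp: w_def)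
    have G: "?G \<epsilon> = ?S w" by (simp add: Gop_def sqrt_square[OF V] z_def w_def)
    \<comment> \<open>Pairing the resolvent equation with the eigenvector \<open>\<eta>\<close>
      expresses \<open>q\<close> as \<open>- \<i> * \<epsilon> * cinner \<eta> w\<close>.\<close>
    have "complex_of_real E * cinner \<eta> w = cinner (H0 \<eta>) w"
      by (simp add: \<eta> cinner_simps)
    also have "\<dots> = cinner \<eta> (V \<eta>) + z * cinner \<eta> w"
      by (simp add: sa_symmetric[OF sa \<eta>(1) w(1)] w(2) cinner_simps)
    finally have "complex_of_real q = (complex_of_real E - z) * cinner \<eta> w"
      by (simp add: q algebra_simps)
    then have "complex_of_real q = - \<i> * complex_of_real \<epsilon> * cinner \<eta> w"
      by (simp add: z(3))
    then have "cmod (complex_of_real q) = cmod (- \<i> * complex_of_real \<epsilon> * cinner \<eta> w)"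
      by (rule arg_cong)
    then have "\<bar>q\<bar> = \<epsilon> * cmod (cinner \<eta> w)" using \<epsilon> by (simp add: norm_mult)
    also have "\<dots> \<le> \<epsilon> * (norm \<eta> * norm w)"
      using \<epsilon> by (intro mult_left_mono Cauchy_Schwarz_cinner) simp
    finally have "\<bar>q\<bar>\<^sup>2 \<le> (\<epsilon> * (norm \<eta> * norm w))\<^sup>2" by (intro power_mono) auto
    then have 1: "q\<^sup>2 \<le> \<epsilon> * (norm \<eta>)\<^sup>2 * (\<epsilon> * (norm w)\<^sup>2)"
      by (simp add: power2_eq_square mult_ac)
    \<comment> \<open>The imaginary part of the resolvent equation paired with \<open>w\<close>
      trades \<open>\<epsilon> * (norm w)\<^sup>2\<close> for a multiple of
      \<open>norm (?G \<epsilon>)\<close>. This leaves one spare factor \<open>\<epsilon>\<close> in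
      the bound for \<open>q\<^sup>2\<close>, which the boundary value sends to 0.\<close>
    have "Im (cinner w (H0 w)) = 0" using sa_Im_zero[OF sa w(1)] .
    then have "\<epsilon> * (norm w)\<^sup>2 = - Im (cinner w (V \<eta>))"
      by (simp add: w(2) cinner_simps cinner_norm z(2))
    also have "cinner w (V \<eta>) = cinner (?S w) (?S \<eta>)"
      by (simp add: sqrt_symmetric[OF V] sqrt_square[OF V])
    also have "- Im \<dots> \<le> norm (?S w) * norm (?S \<eta>)"
      using abs_Im_le_cmod[of "cinner (?S w) (?S \<eta>)"] Cauchy_Schwarz_cinner[of "?S w" "?S \<eta>"] by linarith
    finally have "\<epsilon> * (norm w)\<^sup>2 \<le> norm (?S \<eta>) * norm (?G \<epsilon>)" by (simp add: G mult.commute)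
    then have "\<epsilon> * (norm \<eta>)\<^sup>2 * (\<epsilon> * (norm w)\<^sup>2) \<le> \<epsilon> * (norm \<eta>)\<^sup>2 * (norm (?S \<eta>) * norm (?G \<epsilon>))"
      using \<epsilon> by (intro mult_left_mono) auto
    with 1 show ?thesis by (simp add: mult_ac)
  qed
  have "((\<lambda>\<epsilon>. \<epsilon> * ((norm \<eta>)\<^sup>2 * (norm (?S \<eta>) * norm (?G \<epsilon>)))) \<longlongrightarrow>
      0 * ((norm \<eta>)\<^sup>2 * (norm (?S \<eta>) * norm l))) (at_right 0)"
    by (intro tendsto_mult tendsto_const tendsto_norm lim tendsto_ident_at)
  then have "q\<^sup>2 \<le> 0 * ((norm \<eta>)\<^sup>2 * (norm (?S \<eta>) * norm l))"
    by (rule tendsto_lowerbound) (auto simp: eventually_at_filter bound)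
  then have "cinner (?S \<eta>) (?S \<eta>) = 0" by (simp add: sqrt_symmetric[OF V] sqrt_square[OF V] q)
  then show ?thesis by (simp add: cinner_eq_0_iff)
qed

text \<open>Applying the resolvent to \<open>H0 \<psi> - z *\<^sub>C \<psi> = - t *\<^sub>C V \<psi>
  - \<i> * \<epsilon> *\<^sub>C \<psi>\<close> yields \<open>G_eq\<close>, the eigenvalue equation
  up to an error involving \<open>r \<epsilon>\<close>. The family \<open>r\<close> is merely
  bounded, so the error is removed weakly, by testing against the defect \<open>y\<close>.\<close>

lemma boundary_value_eigenvector:
  assumes t: "t \<noteq> 0" and \<psi>: "\<psi> \<in> D"
    and eig: "H0 \<psi> + complex_of_real t *\<^sub>C V \<psi> = complex_of_real E *\<^sub>C \<psi>"
    and lim: "\<And>x. ((\<lambda>\<epsilon>. Gop D H0 V (complex_of_real E + \<i> * complex_of_real \<epsilon>) x) \<longlongrightarrow> L x) (at_right 0)"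
  shows "L (op_sqrt V \<psi>) = complex_of_real (- 1 / t) *\<^sub>C op_sqrt V \<psi>"
proof -
  let ?S = "op_sqrt V"
  define z where "z \<epsilon> = complex_of_real E + \<i> * complex_of_real \<epsilon>" for \<epsilon> :: real
  define r where "r \<epsilon> = complex_of_real \<epsilon> *\<^sub>C resolvent D H0 (z \<epsilon>) \<psi>" for \<epsilon> :: real
  define c where "c = complex_of_real (- 1 / t)"
  define y where "y = L (?S \<psi>) - c *\<^sub>C ?S \<psi>"
  have S_add: "?S (x + y) = ?S x + ?S y" and S_scaleC: "?S (a *\<^sub>C x) = a *\<^sub>C ?S x" for x y a
    using nonneg_op_clinear[OF sqrt_nonneg[OF V]] by (auto simp: clinear_op_def)
  have pos: "\<forall>\<^sub>F \<epsilon> in at_right 0. \<epsilon> > (0::real)" by (simp add: eventually_at_filter)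
  have r_dom: "r \<epsilon> \<in> D"
    and r_eq: "H0 (r \<epsilon>) = complex_of_real \<epsilon> *\<^sub>C \<psi> + z \<epsilon> *\<^sub>C r \<epsilon>"
    and r_le: "norm (r \<epsilon>) \<le> norm \<psi>" if "\<epsilon> > 0" for \<epsilon>
  proof -
    have z: "Im (z \<epsilon>) \<noteq> 0" "Im (z \<epsilon>) = \<epsilon>" using that by (auto simp: z_def)
    note R = resolvent_solves[OF sa z(1), of \<psi>]
    show "r \<epsilon> \<in> D" using R(1) sa_dom_scaleC[OF sa] by (simp add: r_def)
    show "H0 (r \<epsilon>) = complex_of_real \<epsilon> *\<^sub>C \<psi> + z \<epsilon> *\<^sub>C r \<epsilon>"
      using R by (simp add: r_def sa_scaleC[OF sa] scaleC_add_right scaleC_scaleC mult.commute)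
    show "norm (r \<epsilon>) \<le> norm \<psi>"
      using norm_resolvent_le[OF sa z(1), of \<psi>] that by (simp add: r_def norm_scaleC z(2))
  qed
  have G_eq: "Gop D H0 V (z \<epsilon>) (?S \<psi>) = c *\<^sub>C ?S \<psi> + (c * \<i>) *\<^sub>C ?S (r \<epsilon>)" if "\<epsilon> > 0" for \<epsilon>
  proof -
    have z: "Im (z \<epsilon>) \<noteq> 0" using that by (auto simp: z_def)
    have "resolvent D H0 (z \<epsilon>) (V \<psi>) = c *\<^sub>C (\<psi> + \<i> *\<^sub>C r \<epsilon>)"
    proof (rule resolvent_eqI[OF sa z])
      have dom: "\<i> *\<^sub>C r \<epsilon> \<in> D" "\<psi> + \<i> *\<^sub>C r \<epsilon> \<in> D"
        using \<psi> r_dom[OF that] sa_dom_scaleC[OF sa] sa_dom_add[OF sa] by auto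
      then show "c *\<^sub>C (\<psi> + \<i> *\<^sub>C r \<epsilon>) \<in> D" using sa_dom_scaleC[OF sa] by auto
      have H\<psi>: "H0 \<psi> = complex_of_real E *\<^sub>C \<psi> - complex_of_real t *\<^sub>C V \<psi>"
        using eig by (simp add: eq_diff_eq)
      have "H0 (\<psi> + \<i> *\<^sub>C r \<epsilon>) - z \<epsilon> *\<^sub>C (\<psi> + \<i> *\<^sub>C r \<epsilon>) = - (complex_of_real t *\<^sub>C V \<psi>)"
        by (simp add: sa_add[OF sa \<psi> dom(1)] sa_scaleC[OF sa r_dom[OF that]] r_eq[OF that] H\<psi>
            scaleC_add_right scaleC_scaleC)
          (simp add: z_def scaleC_add_left mult.commute)
      then have "c *\<^sub>C (H0 (\<psi> + \<i> *\<^sub>C r \<epsilon>) - z \<epsilon> *\<^sub>C (\<psi> + \<i> *\<^sub>C r \<epsilon>)) = V \<psi>"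
        using t by (simp add: c_def scaleC_scaleC scaleC_minus_right scaleC_minus_left scaleC_one)
      then show "H0 (c *\<^sub>C (\<psi> + \<i> *\<^sub>C r \<epsilon>)) - z \<epsilon> *\<^sub>C c *\<^sub>C (\<psi> + \<i> *\<^sub>C r \<epsilon>) = V \<psi>"
        by (simp add: sa_scaleC[OF sa dom(2)] scaleC_diff_right scaleC_scaleC mult.commute)
    qed
    then show ?thesis by (simp add: Gop_def sqrt_square[OF V] S_add S_scaleC scaleC_add_right scaleC_scaleC)
  qed
  \<comment> \<open>The vectors asymptotically orthogonal to \<open>r\<close>. They form a closed
    subspace containing the range of \<open>H0 - E\<close>, so its complement lies in the kernel of
    \<open>H0 - E\<close>, which \<open>op_sqrt V\<close> kills; therefore \<open>M\<close> contains
    the range of \<open>op_sqrt V\<close>.\<close>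
  define M where "M = {w. ((\<lambda>\<epsilon>. cinner w (r \<epsilon>)) \<longlongrightarrow> 0) (at_right 0)}"
  have "?S y \<in> M"
  proof (rule closed_csubspace_memI)
    show "csubspace M" unfolding M_def by (rule csubspace_weakly_null)
    show "closed M" unfolding M_def
      by (rule closed_weakly_null[where C = "norm \<psi>"]) (use pos r_le in \<open>auto elim: eventually_mono\<close>)
    have range_M: "H0 v - complex_of_real E *\<^sub>C v \<in> M" if v: "v \<in> D" for v
    proof -
      have "((\<lambda>\<epsilon>. cinner (H0 v - complex_of_real E *\<^sub>C v) (r \<epsilon>)) \<longlongrightarrow> 0) (at_right 0)"
      proof (rule Lim_null_comparison)
        show "\<forall>\<^sub>F \<epsilon> in at_right 0. cmod (cinner (H0 v - complex_of_real E *\<^sub>C v) (r \<epsilon>))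
            \<le> \<epsilon> * (norm v * (2 * norm \<psi>))"
          using pos
        proof eventually_elim
          fix \<epsilon> :: real assume \<epsilon>: "\<epsilon> > 0"
          \<comment> \<open>Moving \<open>H0 - E\<close> onto \<open>r \<epsilon>\<close> leaves
            only terms of order \<open>\<epsilon>\<close>.\<close>
          have "cinner (H0 v - complex_of_real E *\<^sub>C v) (r \<epsilon>)
              = cinner v (complex_of_real \<epsilon> *\<^sub>C (\<psi> + \<i> *\<^sub>C r \<epsilon>))"
            by (simp add: cinner_simps sa_symmetric[OF sa v r_dom[OF \<epsilon>]] r_eq[OF \<epsilon>] z_def algebra_simps)
          also have "cmod \<dots> \<le> norm v * norm (complex_of_real \<epsilon> *\<^sub>C (\<psi> + \<i> *\<^sub>C r \<epsilon>))"
            by (rule Cauchy_Schwarz_cinner)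
          also have "\<dots> = norm v * (\<epsilon> * norm (\<psi> + \<i> *\<^sub>C r \<epsilon>))"
            using \<epsilon> by (simp add: norm_scaleC)
          also have "\<dots> \<le> norm v * (\<epsilon> * (2 * norm \<psi>))"
            using \<epsilon> norm_triangle_ineq[of \<psi> "\<i> *\<^sub>C r \<epsilon>"] r_le[OF \<epsilon>]
            by (intro mult_left_mono) (auto simp: norm_scaleC)
          finally show "cmod (cinner (H0 v - complex_of_real E *\<^sub>C v) (r \<epsilon>)) \<le> \<epsilon> * (norm v * (2 * norm \<psi>))"
            by (simp add: mult_ac)
        qed
        show "((\<lambda>\<epsilon>. \<epsilon> * (norm v * (2 * norm \<psi>))) \<longlongrightarrow> 0) (at_right 0)"
          by (intro tendsto_mult_left_zero tendsto_ident_at)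
      qed
      then show ?thesis by (simp add: M_def)
    qed
    fix q assume q: "\<And>m. m \<in> M \<Longrightarrow> cinner m q = 0"
    have "q \<in> D \<and> H0 q = complex_of_real E *\<^sub>C q"
    proof (rule sa_adjointD[OF sa])
      fix x assume "x \<in> D"
      then have "cinner (H0 x - complex_of_real E *\<^sub>C x) q = 0" using q range_M by blast
      then show "cinner (H0 x) q = cinner x (complex_of_real E *\<^sub>C q)" by (simp add: cinner_simps)
    qed
    then have "?S q = 0" using eigenvector_killed_of_boundary_value lim by blast
    then show "cinner q (?S y) = 0" by (metis cinner_zero_left sqrt_symmetric[OF V])
  qed
  then have "((\<lambda>\<epsilon>. (c * \<i>) * cinner (?S y) (r \<epsilon>)) \<longlongrightarrow> 0) (at_right 0)"
    by (auto simp: M_def intro: tendsto_mult_right_zero)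
  \<comment> \<open>The same expression tends to \<open>cinner y y\<close> by the norm limit of
    \<open>Gop\<close> and to 0 by \<open>?S y \<in> M\<close>.\<close>
  moreover have "((\<lambda>\<epsilon>. (c * \<i>) * cinner (?S y) (r \<epsilon>)) \<longlongrightarrow> cinner y y) (at_right 0)"
  proof (rule Lim_transform_eventually)
    show "((\<lambda>\<epsilon>. cinner y (Gop D H0 V (z \<epsilon>) (?S \<psi>) - c *\<^sub>C ?S \<psi>)) \<longlongrightarrow> cinner y y) (at_right 0)"
      unfolding y_def by (intro tendsto_cinner tendsto_const tendsto_diff lim[folded z_def])
    show "\<forall>\<^sub>F \<epsilon> in at_right 0. cinner y (Gop D H0 V (z \<epsilon>) (?S \<psi>) - c *\<^sub>C ?S \<psi>) = (c * \<i>) * cinner (?S y) (r \<epsilon>)"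
      using pos by eventually_elim (simp add: G_eq cinner_scaleC_right sqrt_symmetric[OF V])
  qed
  ultimately have "cinner y y = 0"
    using tendsto_unique[OF trivial_limit_at_right_real] by blast
  then show ?thesis by (simp add: cinner_eq_0_iff y_def c_def)
qed

text \<open>If \<open>V\<close> kills \<open>\<psi>\<close>, the orthogonal complement of
  \<open>\<psi>\<close> is reducing for \<open>H0\<close> and contains the range of
  \<open>V\<close>. By minimality it contains \<open>HV D H0 V\<close>, so \<open>\<psi>\<close>
  would be orthogonal to itself.\<close>

lemma HV_eigenvector_not_killed:
  assumes \<psi>: "\<psi> \<in> D" "\<psi> \<in> HV D H0 V" "H0 \<psi> = complex_of_real E *\<^sub>C \<psi>" and "V \<psi> = 0"
  shows "\<psi> = 0"
proof (rule ccontr)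
  assume ne: "\<psi> \<noteq> 0"
  define M where "M = {x. cinner \<psi> x = 0}"
  define c where "c x = cinner \<psi> x / cinner \<psi> \<psi>" for x
  have n: "cinner \<psi> \<psi> \<noteq> 0" using ne by (simp add: cinner_eq_0_iff)
  have sub: "csubspace M" by (auto simp: M_def csubspace_def cinner_simps)
  have M\<psi>: "cinner m \<psi> = 0" if "m \<in> M" for m
    using that cinner_commute[of m \<psi>] by (simp add: M_def)
  have proj: "oproj M x = x - c x *\<^sub>C \<psi>" for x
  proof (rule oproj_eqI[OF sub])
    show "x - c x *\<^sub>C \<psi> \<in> M" using n by (simp add: M_def c_def cinner_simps)
    show "cinner m (x - (x - c x *\<^sub>C \<psi>)) = 0" if "m \<in> M" for m
      using M\<psi>[OF that] by (simp add: cinner_simps)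
  qed
  have "closed M"
    unfolding closed_sequential_limits
  proof (intro allI impI, elim conjE)
    fix f l assume f: "\<forall>n. f n \<in> M" "f \<longlonglongrightarrow> l"
    have "(\<lambda>n. cinner \<psi> (f n)) \<longlonglongrightarrow> cinner \<psi> l" by (intro tendsto_cinner tendsto_const f)
    then show "l \<in> M" using f(1) by (simp add: M_def LIMSEQ_const_iff)
  qed
  moreover have "oproj M x \<in> D \<and> H0 (oproj M x) = oproj M (H0 x)" if x: "x \<in> D" for x
  proof -
    have dom: "c x *\<^sub>C \<psi> \<in> D" using \<psi>(1) by (rule sa_dom_scaleC[OF sa])
    have "cinner \<psi> (H0 x) = complex_of_real E * cinner \<psi> x"
      using sa_symmetric[OF sa \<psi>(1) x] by (simp add: \<psi>(3) cinner_simps)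
    then have "c (H0 x) = c x * complex_of_real E" by (simp add: c_def)
    then show ?thesis
      using sa_dom_diff[OF sa x dom] sa_diff[OF sa x dom]
      by (simp add: proj sa_scaleC[OF sa \<psi>(1)] \<psi>(3) scaleC_scaleC)
  qed
  moreover have "range V \<subseteq> M"
    using \<open>V \<psi> = 0\<close> nonneg_op_symmetric[OF V, of \<psi>] by (auto simp: M_def)
  ultimately have "\<psi> \<in> M"
    using \<psi>(2) sub by (auto simp: HV_def reducing_subspace_def)
  then show False using n by (simp add: M_def)
qed

text \<open>Eigenvalues are quantified over the complex numbers, boundary values over real energies;
  this connects the two.\<close>

lemma eigenvalue_real:
  assumes \<psi>: "\<psi> \<in> D" "\<psi> \<noteq> 0" and eig: "H0 \<psi> + complex_of_real t *\<^sub>C V \<psi> = \<mu> *\<^sub>C \<psi>"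
  shows "\<mu> = complex_of_real (Re \<mu>)"
proof -
  have "Im (cinner \<psi> (H0 \<psi> + complex_of_real t *\<^sub>C V \<psi>)) = 0"
    using sa_Im_zero[OF sa \<psi>(1)] V by (simp add: cinner_simps nonneg_op_def)
  then have "Im \<mu> * (norm \<psi>)\<^sup>2 = 0" by (simp add: eig cinner_simps cinner_norm)
  then show ?thesis using \<psi>(2) by (simp add: complex_eq_iff)
qed

text \<open>Pair each eigenvalue equation with the other eigenvector and cancel the
  \<open>H0\<close> terms by symmetry.\<close>

lemma eigenpair_identity:
  assumes 1: "\<psi> \<in> D" "H0 \<psi> + complex_of_real t *\<^sub>C V \<psi> = complex_of_real E *\<^sub>C \<psi>"
    and 2: "\<psi>' \<in> D" "H0 \<psi>' + complex_of_real t' *\<^sub>C V \<psi>' = complex_of_real E' *\<^sub>C \<psi>'"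
  shows "complex_of_real (t' - t) * cinner \<psi> (V \<psi>') = complex_of_real (E' - E) * cinner \<psi> \<psi>'"
proof -
  have H0: "H0 \<psi> = complex_of_real E *\<^sub>C \<psi> - complex_of_real t *\<^sub>C V \<psi>"
    "H0 \<psi>' = complex_of_real E' *\<^sub>C \<psi>' - complex_of_real t' *\<^sub>C V \<psi>'"
    using 1(2) 2(2) by (simp_all add: eq_diff_eq)
  show ?thesis
    using sa_symmetric[OF sa 1(1) 2(1)] unfolding H0
    by (simp add: cinner_simps nonneg_op_symmetric[OF V] algebra_simps)
qed

end

section \<open>Exceptional coupling constants\<close>

text \<open>Second countability cuts the vectors with \<open>V \<psi> \<noteq> 0\<close> into
  countably many open pieces, on each of which \<open>eigenpair_identity\<close> makes the coupling
  a Lipschitz function of the energy.\<close>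

lemma negligible_couplings_with_eigenvalue_in:
  fixes D :: "'a::{complex_hilbert, second_countable_topology} set" and H0 V :: "'a \<Rightarrow> 'a"
  assumes sa: "self_adjoint_op D H0" and V: "nonneg_op V" and N: "negligible (N :: real set)"
  shows "negligible {t. \<exists>E\<in>N. \<exists>\<psi>\<in>D. V \<psi> \<noteq> 0 \<and>
    H0 \<psi> + complex_of_real t *\<^sub>C V \<psi> = complex_of_real E *\<^sub>C \<psi>}"
proof -
  define eig where "eig U E t \<longleftrightarrow> (\<exists>\<psi>\<in>U \<inter> D. V \<psi> \<noteq> 0 \<and>
      H0 \<psi> + complex_of_real t *\<^sub>C V \<psi> = complex_of_real E *\<^sub>C \<psi>)" for U E t
  \<comment> \<open>The lower bound is demanded for all pairs in \<open>U\<close>, not only on the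
    diagonal, because the identity compares two different eigenvectors.\<close>
  define \<F> where "\<F> = {U. open U \<and> (\<exists>c>0. \<exists>C. \<forall>x\<in>U. \<forall>y\<in>U. c \<le> cmod (cinner x (V y)) \<and> norm x \<le> C)}"
  obtain \<F>' where F': "\<F>' \<subseteq> \<F>" "countable \<F>'" "\<Union>\<F>' = \<Union>\<F>"
    using Lindelof[of \<F>] by (auto simp: \<F>_def)
  have cover: "\<exists>U\<in>\<F>. \<psi> \<in> U" if "V \<psi> \<noteq> 0" for \<psi>
  proof -
    define c where "c = cmod (cinner \<psi> (V \<psi>)) / 2"
    have "Re (cinner \<psi> (V \<psi>)) \<noteq> 0" using nonneg_op_kernel[OF V] that by blast
    then have c: "c > 0" by (auto simp: c_def)
    \<comment> \<open>Joint continuity at \<open>(\<psi>, \<psi>)\<close> keeps the form above half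
      of its value there.\<close>
    have "open {p :: 'a \<times> 'a. c < cmod (cinner (fst p) (V (snd p)))}"
      by (intro open_Collect_less continuous_intros continuous_on_norm
          bounded_bilinear.continuous_on[OF bounded_bilinear_cinner]
          bounded_linear.continuous_on[OF nonneg_op_bounded_linear[OF V]])
    moreover have "(\<psi>, \<psi>) \<in> {p. c < cmod (cinner (fst p) (V (snd p)))}"
      using c by (simp add: c_def)
    ultimately obtain A B where AB: "open A" "open B" "(\<psi>, \<psi>) \<in> A \<times> B"
      "A \<times> B \<subseteq> {p. c < cmod (cinner (fst p) (V (snd p)))}"
      by (rule open_prod_elim)
    define U where "U = A \<inter> B \<inter> ball 0 (norm \<psi> + 1)"
    have "c \<le> cmod (cinner x (V y)) \<and> norm x \<le> norm \<psi> + 1" if "x \<in> U" "y \<in> U" for x y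
      using that subsetD[OF AB(4), of "(x, y)"] by (auto simp: U_def)
    moreover have "open U" using AB by (auto simp: U_def)
    ultimately have "U \<in> \<F>" using c unfolding \<F>_def by blast
    moreover have "\<psi> \<in> U" using AB(3) by (auto simp: U_def)
    ultimately show ?thesis by blast
  qed
  have piece: "negligible {t. \<exists>E\<in>N. eig U E t}" if U: "U \<in> \<F>" for U
  proof -
    obtain c C where c: "c > 0" and
      cC: "\<And>x y. x \<in> U \<Longrightarrow> y \<in> U \<Longrightarrow> c \<le> cmod (cinner x (V y)) \<and> norm x \<le> C"
      using U unfolding \<F>_def by blast
    have lip: "\<bar>t' - t\<bar> \<le> (C\<^sup>2 / c) * \<bar>E' - E\<bar>" if e: "eig U E t" "eig U E' t'" for E t E' t'
    proof -
      obtain \<psi> \<psi>' where \<psi>: "\<psi> \<in> U" "\<psi> \<in> D" "H0 \<psi> + complex_of_real t *\<^sub>C V \<psi> = complex_of_real E *\<^sub>C \<psi>"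
        and \<psi>': "\<psi>' \<in> U" "\<psi>' \<in> D" "H0 \<psi>' + complex_of_real t' *\<^sub>C V \<psi>' = complex_of_real E' *\<^sub>C \<psi>'"
        using e unfolding eig_def by blast
      have "\<bar>t' - t\<bar> * c \<le> \<bar>t' - t\<bar> * cmod (cinner \<psi> (V \<psi>'))"
        using cC \<psi>(1) \<psi>'(1) by (intro mult_left_mono) auto
      also have "\<dots> = cmod (complex_of_real (t' - t) * cinner \<psi> (V \<psi>'))"
        by (simp only: norm_mult norm_of_real)
      also have "\<dots> = \<bar>E' - E\<bar> * cmod (cinner \<psi> \<psi>')"
        by (simp only: eigenpair_identity[OF sa V \<psi>(2,3) \<psi>'(2,3)] norm_mult norm_of_real)
      also have "\<dots> \<le> \<bar>E' - E\<bar> * (norm \<psi> * norm \<psi>')"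
        by (intro mult_left_mono Cauchy_Schwarz_cinner) simp
      also have "\<dots> \<le> \<bar>E' - E\<bar> * (C * C)"
      proof (intro mult_left_mono mult_mono)
        show "norm \<psi> \<le> C" "norm \<psi>' \<le> C" using cC \<psi>(1) \<psi>'(1) by blast+
        then show "0 \<le> C" using norm_ge_zero order_trans by blast
      qed simp_all
      finally show ?thesis
        using c by (simp add: field_simps power2_eq_square)
    qed
    define f where "f E = (SOME t. eig U E t)" for E
    have f: "eig U E (f E)" if "eig U E t" for E t
      unfolding f_def using that by (rule someI)
    define N' where "N' = {E \<in> N. \<exists>t. eig U E t}"
    have "negligible N'" using N by (rule negligible_subset) (auto simp: N'_def)
    then have "negligible (f ` N')"
    proof (rule negligible_locally_Lipschitz_image[rotated])
      fix E assume "E \<in> N'"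
      then have "norm (f y - f E) \<le> (C\<^sup>2 / c) * norm (y - E)" if "y \<in> N'" for y
        using that lip[of E "f E" y "f y"] f by (auto simp: N'_def)
      then show "\<exists>T B. open T \<and> E \<in> T \<and> (\<forall>y\<in>N' \<inter> T. norm (f y - f E) \<le> B * norm (y - E))"
        by (intro exI[of _ UNIV] exI[of _ "C\<^sup>2 / c"]) auto
    qed simp
    moreover have "{t. \<exists>E\<in>N. eig U E t} \<subseteq> f ` N'"
    proof
      fix t assume "t \<in> {t. \<exists>E\<in>N. eig U E t}"
      then obtain E where E: "E \<in> N" "eig U E t" by blast
      then have "t = f E" using lip[OF E(2) f[OF E(2)]] by simp
      then show "t \<in> f ` N'" using E by (auto simp: N'_def)
    qed
    ultimately show ?thesis by (rule negligible_subset)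
  qed
  have "negligible (\<Union>U\<in>\<F>'. {t. \<exists>E\<in>N. eig U E t})"
    using F' piece by (intro negligible_countable_Union) auto
  then show ?thesis
    by (rule negligible_subset) (use cover F'(3) in \<open>fastforce simp: eig_def\<close>)
qed

text \<open>\<open>op_sqrt V\<close> maps the eigenspace injectively into the generalized eigenspace
  of \<open>L\<close> at \<open>-1/t\<close>, which is a line by simplicity.\<close>

lemma one_dim_eigenspace_of_boundary_value:
  fixes D :: "'a::complex_hilbert set"
  assumes sa: "self_adjoint_op D H0" and V: "nonneg_op V"
    and lim: "\<And>x. ((\<lambda>\<epsilon>. Gop D H0 V (complex_of_real E + \<i> * complex_of_real \<epsilon>) x) \<longlongrightarrow> L x) (at_right 0)"
    and simple: "\<And>\<mu>. \<mu> \<noteq> 0 \<Longrightarrow> is_eigenvalue L \<mu> \<Longrightarrow> algebraically_simple L \<mu>"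
    and \<psi>: "\<psi> \<in> restr_eigenspace D (\<lambda>x. H0 x + complex_of_real t *\<^sub>C V x) (HV D H0 V) (complex_of_real E)"
      "\<psi> \<noteq> 0"
  shows "one_dim (restr_eigenspace D (\<lambda>x. H0 x + complex_of_real t *\<^sub>C V x) (HV D H0 V) (complex_of_real E))"
    (is "one_dim ?W")
proof -
  let ?S = "op_sqrt V"
  have linS: "clinear_op ?S" by (rule nonneg_op_clinear[OF sqrt_nonneg[OF V]])
  have linV: "clinear_op V" by (rule nonneg_op_clinear[OF V])
  have W: "x \<in> ?W \<longleftrightarrow> x \<in> D \<and> x \<in> HV D H0 V \<and> H0 x + complex_of_real t *\<^sub>C V x = complex_of_real E *\<^sub>C x" for x
    by (auto simp: restr_eigenspace_def)
  have inj: "x = 0" if "x \<in> ?W" "?S x = 0" for x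
    using that HV_eigenvector_not_killed[OF sa V, of x E] by (simp add: W sqrt_kernel[OF V])
  have scale: "a *\<^sub>C x \<in> ?W" if "x \<in> ?W" for a x
    using that csubspace_HV[of D H0 V] linV
    by (simp add: W sa_dom_scaleC[OF sa] sa_scaleC[OF sa] csubspace_def clinear_op_def)
      (metis scaleC_add_right scaleC_scaleC mult.commute)
  have diff: "x - y \<in> ?W" if "x \<in> ?W" "y \<in> ?W" for x y
    using that csubspace_HV[of D H0 V]
    by (simp add: W sa_dom_diff[OF sa] sa_diff[OF sa] csubspace_diff clinear_op_diff[OF linV]
        scaleC_diff_right) (metis add_diff_add)
  \<comment> \<open>At \<open>t = 0\<close> the vector would be an eigenvector of \<open>H0\<close>,
    which the boundary value forces \<open>op_sqrt V\<close> to kill, against injectivity.\<close>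
  have t: "t \<noteq> 0"
  proof
    assume "t = 0"
    then have "?S \<psi> = 0"
      using \<psi>(1)[unfolded W] by (intro eigenvector_killed_of_boundary_value[OF sa V _ _ lim]) auto
    then show False using inj \<psi> by blast
  qed
  define \<mu> where "\<mu> = complex_of_real (- 1 / t)"
  have eigL: "L (?S x) = \<mu> *\<^sub>C ?S x" if "x \<in> ?W" for x
    using boundary_value_eigenvector[OF sa V t _ _ lim, of x] that by (simp add: W \<mu>_def)
  have S\<psi>: "?S \<psi> \<noteq> 0" using inj \<psi> by blast
  then have "is_eigenvalue L \<mu>" using eigL[OF \<psi>(1)] by (auto simp: is_eigenvalue_def)
  moreover have "\<mu> \<noteq> 0" using t by (simp add: \<mu>_def)
  ultimately obtain v where v: "gen_eigenspace L \<mu> = range (\<lambda>c. c *\<^sub>C v)"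
    using simple unfolding algebraically_simple_def one_dim_def by blast
  have "\<exists>c. ?S x = c *\<^sub>C v" if "x \<in> ?W" for x
  proof -
    have "((\<lambda>y. L y - \<mu> *\<^sub>C y) ^^ 1) (?S x) = 0" using eigL[OF that] by simp
    then have "?S x \<in> gen_eigenspace L \<mu>" unfolding gen_eigenspace_def by blast
    then show ?thesis using v by auto
  qed
  note Sv = this
  obtain c0 where c0: "?S \<psi> = c0 *\<^sub>C v" using Sv[OF \<psi>(1)] by blast
  then have "c0 \<noteq> 0" using S\<psi> by auto
  have "?W = range (\<lambda>c. c *\<^sub>C \<psi>)"
  proof
    show "range (\<lambda>c. c *\<^sub>C \<psi>) \<subseteq> ?W" using scale[OF \<psi>(1)] by blast
    show "?W \<subseteq> range (\<lambda>c. c *\<^sub>C \<psi>)"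
    proof
      fix x assume x: "x \<in> ?W"
      obtain c where c: "?S x = c *\<^sub>C v" using Sv[OF x] by blast
      \<comment> \<open>The multiple of \<open>\<psi>\<close> is chosen to cancel the image under
        \<open>op_sqrt V\<close>; injectivity then gives \<open>y = 0\<close>.\<close>
      define y where "y = x - (c / c0) *\<^sub>C \<psi>"
      have "y \<in> ?W" unfolding y_def by (intro diff scale x \<psi>(1))
      moreover have "?S y = ?S x - (c / c0) *\<^sub>C ?S \<psi>"
        using linS by (simp add: y_def clinear_op_diff[OF linS]) (simp add: clinear_op_def)
      then have "?S y = 0" using \<open>c0 \<noteq> 0\<close> by (simp add: c c0 scaleC_scaleC)
      ultimately have "y = 0" by (rule inj)
      then show "x \<in> range (\<lambda>c. c *\<^sub>C \<psi>)" by (auto simp: y_def)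
    qed
  qed
  then show ?thesis using \<psi>(2) unfolding one_dim_def by blast
qed

lemma tendsto_of_onorm_diff_tendsto_0:
  assumes T: "\<forall>\<^sub>F e in F. bounded_linear (T e)" and L: "bounded_linear L"
    and lim: "((\<lambda>e. onorm (\<lambda>x. T e x - L x)) \<longlongrightarrow> 0) F"
  shows "((\<lambda>e. T e x) \<longlongrightarrow> L x) F"
proof (rule Lim_transform)
  show "((\<lambda>e. L x) \<longlongrightarrow> L x) F" by simp
  show "((\<lambda>e. T e x - L x) \<longlongrightarrow> 0) F"
  proof (rule Lim_null_comparison)
    show "\<forall>\<^sub>F e in F. norm (T e x - L x) \<le> onorm (\<lambda>x. T e x - L x) * norm x"
      using T by eventually_elim (use onorm[OF bounded_linear_sub[OF _ L]] in blast)
    show "((\<lambda>e. onorm (\<lambda>x. T e x - L x) * norm x) \<longlongrightarrow> 0) F"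
      by (intro tendsto_mult_left_zero lim)
  qed
qed

theorem theorem2p2:
  fixes D :: "'a::{complex_hilbert, second_countable_topology} set"
    and H0 :: "'a \<Rightarrow> 'a" and V :: "'a \<Rightarrow> 'a"
  assumes H0_sa: "self_adjoint_op D H0"
    and V_nonneg: "nonneg_op V"
    and G_compact: "\<forall>z. Im z \<noteq> 0 \<longrightarrow> compact_op (Gop D H0 V z)"
    and G_boundary: "AE E in lborel. \<exists>L. bounded_clinear_op L \<and>
          ((\<lambda>\<epsilon>. onorm (\<lambda>x. Gop D H0 V (complex_of_real E + \<i> * complex_of_real \<epsilon>) x - L x))
             \<longlongrightarrow> 0) (at_right 0) \<and>
          (\<forall>\<mu>. \<mu> \<noteq> 0 \<and> is_eigenvalue L \<mu> \<longrightarrow> algebraically_simple L \<mu>)"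
  shows "AE t in lborel. \<forall>\<mu>.
           restr_eigenspace D (\<lambda>x. H0 x + complex_of_real t *\<^sub>C V x) (HV D H0 V) \<mu> \<noteq> {0}
           \<longrightarrow> one_dim (restr_eigenspace D (\<lambda>x. H0 x + complex_of_real t *\<^sub>C V x) (HV D H0 V) \<mu>)"
proof -
  obtain N where N: "N \<in> null_sets lborel" and
    good: "\<And>E. E \<notin> N \<Longrightarrow> \<exists>L. bounded_clinear_op L \<and>
          ((\<lambda>\<epsilon>. onorm (\<lambda>x. Gop D H0 V (complex_of_real E + \<i> * complex_of_real \<epsilon>) x - L x))
             \<longlongrightarrow> 0) (at_right 0) \<and>
          (\<forall>\<mu>. \<mu> \<noteq> 0 \<and> is_eigenvalue L \<mu> \<longrightarrow> algebraically_simple L \<mu>)"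
    by (rule AE_E3[OF G_boundary]) (rule that, assumption, simp)
  have "negligible N"
    using N by (simp add: negligible_iff_null_sets null_sets_completionI)
  define B where "B = {t. \<exists>E\<in>N. \<exists>\<psi>\<in>D. V \<psi> \<noteq> 0 \<and>
    H0 \<psi> + complex_of_real t *\<^sub>C V \<psi> = complex_of_real E *\<^sub>C \<psi>}"
  have "negligible B"
    unfolding B_def by (rule negligible_couplings_with_eigenvalue_in[OF H0_sa V_nonneg \<open>negligible N\<close>])
  \<comment> \<open>\<open>B\<close> is null for the completed measure and need not be visibly
    Borel, so the statement passes through \<open>lebesgue\<close> before returning to
    \<open>lborel\<close>.\<close>
  then have "AE t in lebesgue. t \<notin> B"
    by (intro AE_not_in) (simp add: negligible_iff_null_sets)
  then have "AE t in lborel. t \<notin> B" by (simp add: AE_completion_iff)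
  then show ?thesis
  proof (rule eventually_mono, intro allI impI)
    fix t \<mu>
    let ?W = "restr_eigenspace D (\<lambda>x. H0 x + complex_of_real t *\<^sub>C V x) (HV D H0 V)"
    assume t: "t \<notin> B" and W: "?W \<mu> \<noteq> {0}"
    have "0 \<in> D" using sa_csubspace[OF H0_sa] by (simp add: csubspace_def)
    then have "0 \<in> ?W \<mu>"
      using sa_scaleC[OF H0_sa, of 0 0] csubspace_HV[of D H0 V]
        clinear_op_diff[OF nonneg_op_clinear[OF V_nonneg], of 0 0]
      by (simp add: restr_eigenspace_def csubspace_def)
    with W obtain \<psi> where \<psi>: "\<psi> \<in> ?W \<mu>" "\<psi> \<noteq> 0" by blast
    then have \<psi>D: "\<psi> \<in> D" "\<psi> \<in> HV D H0 V" and eig: "H0 \<psi> + complex_of_real t *\<^sub>C V \<psi> = \<mu> *\<^sub>C \<psi>"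
      by (auto simp: restr_eigenspace_def)
    define E where "E = Re \<mu>"
    have \<mu>: "\<mu> = complex_of_real E"
      unfolding E_def by (rule eigenvalue_real[OF H0_sa V_nonneg \<psi>D(1) \<psi>(2) eig])
    have "V \<psi> \<noteq> 0"
      using HV_eigenvector_not_killed[OF H0_sa V_nonneg \<psi>D, of E] \<psi>(2) eig \<mu> by auto
    then have "E \<notin> N" using t \<psi>D(1) eig unfolding B_def \<mu> by blast
    then obtain L where L: "bounded_clinear_op L"
      and lim: "((\<lambda>\<epsilon>. onorm (\<lambda>x. Gop D H0 V (complex_of_real E + \<i> * complex_of_real \<epsilon>) x - L x))
             \<longlongrightarrow> 0) (at_right 0)"
      and simple: "\<And>\<mu>. \<mu> \<noteq> 0 \<Longrightarrow> is_eigenvalue L \<mu> \<Longrightarrow> algebraically_simple L \<mu>"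
      using good by blast
    \<comment> \<open>Compactness supplies bounded linearity, so that \<open>onorm\<close> really
      bounds the pointwise differences.\<close>
    have "\<forall>\<^sub>F \<epsilon> in at_right 0. bounded_linear (Gop D H0 V (complex_of_real E + \<i> * complex_of_real \<epsilon>))"
      unfolding eventually_at_filter
      by (intro always_eventually allI impI bounded_clinear_op_bounded_linear)
        (use G_compact in \<open>auto simp: compact_op_def\<close>)
    from tendsto_of_onorm_diff_tendsto_0[OF this bounded_clinear_op_bounded_linear[OF L] lim]
    show "one_dim (?W \<mu>)"
      using \<psi> simple unfolding \<mu>
      by (intro one_dim_eigenspace_of_boundary_value[OF H0_sa V_nonneg]) auto
  qed
qed

end
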